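(* Let $H$ be a finite-dimensional ribbon Hopf algebra over a field $\Bbbk$, $\lambda\in H^*$ a non-zero right integral for $H^*$ and $G$ the special grouplike element of $H$. The space $\{z\in L(H):T(z)=z\}$ is $\Bbbk$-isomorphic to the space of traces on $H$ via the map $z\mapsto\lambda\cdot(zG)$.
   Context: $H$ is a finite-dimensional Hopf algebra over $\Bbbk$ (coproduct $\Delta(x)=x_{(1)}\otimes x_{(2)}$, counit $\varepsilon$, antipode $S$), with an R-matrix $R=\sum_ia_i\otimes b_i$ (invertible, $R\Delta(x)=\sigma\Delta(x)R$, $(\mathrm{id}\otimes\Delta)(R)=R_{13}R_{12}$, $(\Delta\otimes\mathrm{id})(R)=R_{13}R_{23}$, $\sigma$ the flip) and a twist $\theta\in H$ (invertible, central, $S(\theta)=\theta$, $\Delta(\theta)=(\theta\otimes\theta)R_{21}R$). $u=\sum_iS(b_i)a_i$ is the Drinfeld element and $G=\theta u$ the special grouplike element. A right integral for $H^*$ is $\lambda\in H^*$ with $\lambda(x_{(1)})x_{(2)}=\lambda(x)1$ for all $x\in H$. $\nu\in H^*$ is the distinguished grouplike element of $H^*$: the algebra map $\nu:H\to\Bbbk$ with $\Lambda x=\nu(x)\Lambda$ for every left integral $\Lambda\in H$ (i.e. $x\Lambda=\varepsilon(x)\Lambda$ for all $x$) and all $x\in H$. $h_\nu=(\mathrm{id}_H\otimes\nu)(R)\in H$. For $f\in H^*$ and $h,x\in H$: $f\cdot h\in H^*$ is $\langle f\cdot h,x\rangle=f(hx)$, and $x\leftharpoonup f=f(x_{(1)})x_{(2)}\in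 H$. $L(H)=\{z\in H:(x\leftharpoonup\nu)z=zx\text{ for all }x\in H\}$. $T:H\to H$, $T(z)=(S(z)\leftharpoonup\nu)h_\nu$. A trace on $H$ is a form $t\in H^*$ with $t(xy)=t(yx)$ and $t(S(x))=t(x)$ for all $x,y\in H$. *)

theory Defs
  imports Complex_Main "HOL-Library.Function_Algebras"
begin

text \<open>
  Tensor products of a vector space with itself are handled through formal sums: the list
  \<open>[(a\<^sub>1, b\<^sub>1), \<dots>, (a\<^sub>n, b\<^sub>n)]\<close> denotes \<open>a\<^sub>1 \<otimes> b\<^sub>1 + \<dots> + a\<^sub>n \<otimes> b\<^sub>n\<close>, and two lists denote the same
  tensor iff they are related by the congruence generated by commutativity of the sum and the
  multilinearity relations.  No separate scalar coefficients are needed, since scalars can be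
  absorbed into a tensor factor.  The tensor square and cube are the quotients by
  \<open>tensor2_eq\<close> and \<open>tensor3_eq\<close>.
\<close>

inductive formal_sum_cong :: "('a list \<Rightarrow> 'a list \<Rightarrow> bool) \<Rightarrow> 'a list \<Rightarrow> 'a list \<Rightarrow> bool"
  for E where
  gen: "E xs ys \<Longrightarrow> formal_sum_cong E xs ys"
| refl: "formal_sum_cong E xs xs"
| sym: "formal_sum_cong E xs ys \<Longrightarrow> formal_sum_cong E ys xs"
| trans: "formal_sum_cong E xs ys \<Longrightarrow> formal_sum_cong E ys zs \<Longrightarrow> formal_sum_cong E xs zs"
| append: "formal_sum_cong E xs ys \<Longrightarrow> formal_sum_cong E xs' ys' \<Longrightarrow>
    formal_sum_cong E (xs @ xs') (ys @ ys')"
| commute: "formal_sum_cong E (xs @ ys) (ys @ xs)"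

inductive bilinear_rel :: "('k \<Rightarrow> 'h \<Rightarrow> 'h) \<Rightarrow> ('h::ab_group_add \<times> 'h) list \<Rightarrow> ('h \<times> 'h) list \<Rightarrow> bool"
  for scale where
  zero: "bilinear_rel scale [(0, b)] []"
| add1: "bilinear_rel scale [(a + a', b)] [(a, b), (a', b)]"
| add2: "bilinear_rel scale [(a, b + b')] [(a, b), (a, b')]"
| scale: "bilinear_rel scale [(scale r a, b)] [(a, scale r b)]"

inductive trilinear_rel ::
    "('k \<Rightarrow> 'h \<Rightarrow> 'h) \<Rightarrow> ('h::ab_group_add \<times> 'h \<times> 'h) list \<Rightarrow> ('h \<times> 'h \<times> 'h) list \<Rightarrow> bool"
  for scale where
  zero: "trilinear_rel scale [(0, b, c)] []"
| add1: "trilinear_rel scale [(a + a', b, c)] [(a, b, c), (a', b, c)]"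
| add2: "trilinear_rel scale [(a, b + b', c)] [(a, b, c), (a, b', c)]"
| add3: "trilinear_rel scale [(a, b, c + c')] [(a, b, c), (a, b, c')]"
| scale12: "trilinear_rel scale [(scale r a, b, c)] [(a, scale r b, c)]"
| scale23: "trilinear_rel scale [(a, scale r b, c)] [(a, b, scale r c)]"

definition tensor2_eq ::
    "('k \<Rightarrow> 'h \<Rightarrow> 'h) \<Rightarrow> ('h::ab_group_add \<times> 'h) list \<Rightarrow> ('h \<times> 'h) list \<Rightarrow> bool" where
  "tensor2_eq scale = formal_sum_cong (bilinear_rel scale)"

definition tensor3_eq ::
    "('k \<Rightarrow> 'h \<Rightarrow> 'h) \<Rightarrow> ('h::ab_group_add \<times> 'h \<times> 'h) list \<Rightarrow> ('h \<times> 'h \<times> 'h) list \<Rightarrow> bool" where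
  "tensor3_eq scale = formal_sum_cong (trilinear_rel scale)"

definition mult2 :: "('h::ring_1 \<times> 'h) list \<Rightarrow> ('h \<times> 'h) list \<Rightarrow> ('h \<times> 'h) list" where
  "mult2 xs ys = [(a * c, b * d). (a, b) \<leftarrow> xs, (c, d) \<leftarrow> ys]"

definition mult3 :: "('h::ring_1 \<times> 'h \<times> 'h) list \<Rightarrow> ('h \<times> 'h \<times> 'h) list \<Rightarrow> ('h \<times> 'h \<times> 'h) list" where
  "mult3 xs ys = [(a * a', b * b', c * c'). (a, b, c) \<leftarrow> xs, (a', b', c') \<leftarrow> ys]"

definition flip2 :: "('h \<times> 'h) list \<Rightarrow> ('h \<times> 'h) list" where
  "flip2 xs = [(b, a). (a, b) \<leftarrow> xs]"

definition leg12 :: "('h::ring_1 \<times> 'h) list \<Rightarrow> ('h \<times> 'h \<times> 'h) list" where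
  "leg12 xs = [(a, b, 1). (a, b) \<leftarrow> xs]"

definition leg13 :: "('h::ring_1 \<times> 'h) list \<Rightarrow> ('h \<times> 'h \<times> 'h) list" where
  "leg13 xs = [(a, 1, b). (a, b) \<leftarrow> xs]"

definition leg23 :: "('h::ring_1 \<times> 'h) list \<Rightarrow> ('h \<times> 'h \<times> 'h) list" where
  "leg23 xs = [(1, a, b). (a, b) \<leftarrow> xs]"

definition cop_id :: "('h \<Rightarrow> ('h \<times> 'h) list) \<Rightarrow> ('h \<times> 'h) list \<Rightarrow> ('h \<times> 'h \<times> 'h) list" where
  "cop_id \<Delta> xs = [(a\<^sub>1, a\<^sub>2, b). (a, b) \<leftarrow> xs, (a\<^sub>1, a\<^sub>2) \<leftarrow> \<Delta> a]"

definition id_cop :: "('h \<Rightarrow> ('h \<times> 'h) list) \<Rightarrow> ('h \<times> 'h) list \<Rightarrow> ('h \<times> 'h \<times> 'h) list" where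
  "id_cop \<Delta> xs = [(a, b\<^sub>1, b\<^sub>2). (a, b) \<leftarrow> xs, (b\<^sub>1, b\<^sub>2) \<leftarrow> \<Delta> b]"

text \<open>
  The type class \<open>ring_1\<close> includes \<open>0 \<noteq> 1\<close>; this is no restriction for Hopf algebras, where it
  follows from \<open>\<epsilon> 1 = 1\<close>.
\<close>

locale algebra_over = vector_space scale
  for scale :: "'k::field \<Rightarrow> 'h::ring_1 \<Rightarrow> 'h" (infixr \<open>*s\<close> 75) +
  assumes scale_mult_left: "(r *s x) * y = r *s (x * y)"
    and scale_mult_right: "x * (r *s y) = r *s (x * y)"

text \<open>
  \<open>\<Delta> x\<close> is some formal sum representing the coproduct of \<open>x\<close>, so linearity and all the other laws
  for \<open>\<Delta>\<close> are required modulo equality of tensors only.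
\<close>

locale hopf_algebra = algebra_over scale
  for scale :: "'k::field \<Rightarrow> 'h::ring_1 \<Rightarrow> 'h" (infixr \<open>*s\<close> 75) +
  fixes \<Delta> :: "'h \<Rightarrow> ('h \<times> 'h) list"
    and \<epsilon> :: "'h \<Rightarrow> 'k"
    and S :: "'h \<Rightarrow> 'h"
  assumes cop_add: "tensor2_eq scale (\<Delta> (x + y)) (\<Delta> x @ \<Delta> y)"
    and cop_scale: "tensor2_eq scale (\<Delta> (r *s x)) [(r *s a, b). (a, b) \<leftarrow> \<Delta> x]"
    and coassoc: "tensor3_eq scale (cop_id \<Delta> (\<Delta> x)) (id_cop \<Delta> (\<Delta> x))"
    and counit_linear: "Vector_Spaces.linear scale (*) \<epsilon>"
    and counit_left: "(\<Sum>(a, b)\<leftarrow>\<Delta> x. \<epsilon> a *s b) = x"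
    and counit_right: "(\<Sum>(a, b)\<leftarrow>\<Delta> x. \<epsilon> b *s a) = x"
    and cop_mult: "tensor2_eq scale (\<Delta> (x * y)) (mult2 (\<Delta> x) (\<Delta> y))"
    and cop_one: "tensor2_eq scale (\<Delta> 1) [(1, 1)]"
    and counit_mult: "\<epsilon> (x * y) = \<epsilon> x * \<epsilon> y"
    and counit_one: "\<epsilon> 1 = 1"
    and antipode_linear: "Vector_Spaces.linear scale scale S"
    and antipode_left: "(\<Sum>(a, b)\<leftarrow>\<Delta> x. S a * b) = \<epsilon> x *s 1"
    and antipode_right: "(\<Sum>(a, b)\<leftarrow>\<Delta> x. a * S b) = \<epsilon> x *s 1"

locale ribbon_hopf_algebra = hopf_algebra scale \<Delta> \<epsilon> S
  for scale :: "'k::field \<Rightarrow> 'h::ring_1 \<Rightarrow> 'h" (infixr \<open>*s\<close> 75)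
    and \<Delta> :: "'h \<Rightarrow> ('h \<times> 'h) list"
    and \<epsilon> :: "'h \<Rightarrow> 'k"
    and S :: "'h \<Rightarrow> 'h" +
  fixes R :: "('h \<times> 'h) list"
    and \<theta> :: 'h
  assumes R_invertible:
      "\<exists>R'. tensor2_eq scale (mult2 R R') [(1, 1)] \<and> tensor2_eq scale (mult2 R' R) [(1, 1)]"
    and R_cop: "tensor2_eq scale (mult2 R (\<Delta> x)) (mult2 (flip2 (\<Delta> x)) R)"
    and R_id_cop: "tensor3_eq scale (id_cop \<Delta> R) (mult3 (leg13 R) (leg12 R))"
    and R_cop_id: "tensor3_eq scale (cop_id \<Delta> R) (mult3 (leg13 R) (leg23 R))"
    and twist_invertible: "\<exists>\<theta>'. \<theta> * \<theta>' = 1 \<and> \<theta>' * \<theta> = 1"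
    and twist_central: "\<theta> * x = x * \<theta>"
    and twist_antipode: "S \<theta> = \<theta>"
    and twist_cop: "tensor2_eq scale (\<Delta> \<theta>) (mult2 (mult2 [(\<theta>, \<theta>)] (flip2 R)) R)"

definition drinfeld_element :: "('h \<Rightarrow> 'h) \<Rightarrow> ('h \<times> 'h) list \<Rightarrow> 'h::ring_1" where
  "drinfeld_element S R = (\<Sum>(a, b)\<leftarrow>R. S b * a)"

definition special_grouplike :: "('h \<Rightarrow> 'h) \<Rightarrow> ('h \<times> 'h) list \<Rightarrow> 'h \<Rightarrow> 'h::ring_1" where
  "special_grouplike S R \<theta> = \<theta> * drinfeld_element S R"

definition act_right ::
    "('k \<Rightarrow> 'h \<Rightarrow> 'h) \<Rightarrow> ('h \<Rightarrow> ('h \<times> 'h) list) \<Rightarrow> 'h \<Rightarrow> ('h \<Rightarrow> 'k) \<Rightarrow> 'h::ring_1" where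
  "act_right scale \<Delta> x f = (\<Sum>(a, b)\<leftarrow>\<Delta> x. scale (f a) b)"

definition dual_mult :: "('h::ring_1 \<Rightarrow> 'k) \<Rightarrow> 'h \<Rightarrow> ('h \<Rightarrow> 'k)" where
  "dual_mult f h = (\<lambda>x. f (h * x))"

definition right_integral_dual ::
    "('k::field \<Rightarrow> 'h::ring_1 \<Rightarrow> 'h) \<Rightarrow> ('h \<Rightarrow> ('h \<times> 'h) list) \<Rightarrow> ('h \<Rightarrow> 'k) \<Rightarrow> bool" where
  "right_integral_dual scale \<Delta> lam \<longleftrightarrow>
    Vector_Spaces.linear scale (*) lam \<and>
    (\<forall>x. (\<Sum>(a, b)\<leftarrow>\<Delta> x. scale (lam a) b) = scale (lam x) 1)"

definition left_integral ::
    "('k::field \<Rightarrow> 'h::ring_1 \<Rightarrow> 'h) \<Rightarrow> ('h \<Rightarrow> 'k) \<Rightarrow> 'h \<Rightarrow> bool" where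
  "left_integral scale \<epsilon> \<Lambda> \<longleftrightarrow> (\<forall>x. x * \<Lambda> = scale (\<epsilon> x) \<Lambda>)"

definition distinguished_grouplike ::
    "('k::field \<Rightarrow> 'h::ring_1 \<Rightarrow> 'h) \<Rightarrow> ('h \<Rightarrow> 'k) \<Rightarrow> ('h \<Rightarrow> 'k)" where
  "distinguished_grouplike scale \<epsilon> =
    (THE \<nu>. Vector_Spaces.linear scale (*) \<nu> \<and> \<nu> 1 = 1 \<and> (\<forall>x y. \<nu> (x * y) = \<nu> x * \<nu> y) \<and>
       (\<forall>\<Lambda>. left_integral scale \<epsilon> \<Lambda> \<longrightarrow> (\<forall>x. \<Lambda> * x = scale (\<nu> x) \<Lambda>)))"

definition h_nu ::
    "('k::field \<Rightarrow> 'h::ring_1 \<Rightarrow> 'h) \<Rightarrow> ('h \<Rightarrow> 'k) \<Rightarrow> ('h \<times> 'h) list \<Rightarrow> 'h" where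
  "h_nu scale \<epsilon> R = (\<Sum>(a, b)\<leftarrow>R. scale (distinguished_grouplike scale \<epsilon> b) a)"

definition L_space ::
    "('k::field \<Rightarrow> 'h::ring_1 \<Rightarrow> 'h) \<Rightarrow> ('h \<Rightarrow> ('h \<times> 'h) list) \<Rightarrow> ('h \<Rightarrow> 'k) \<Rightarrow> 'h set" where
  "L_space scale \<Delta> \<epsilon> =
    {z. \<forall>x. act_right scale \<Delta> x (distinguished_grouplike scale \<epsilon>) * z = z * x}"

definition T_map ::
    "('k::field \<Rightarrow> 'h::ring_1 \<Rightarrow> 'h) \<Rightarrow> ('h \<Rightarrow> ('h \<times> 'h) list) \<Rightarrow> ('h \<Rightarrow> 'k) \<Rightarrow> ('h \<Rightarrow> 'h) \<Rightarrow>
      ('h \<times> 'h) list \<Rightarrow> 'h \<Rightarrow> 'h" where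
  "T_map scale \<Delta> \<epsilon> S R z =
    act_right scale \<Delta> (S z) (distinguished_grouplike scale \<epsilon>) * h_nu scale \<epsilon> R"

definition traces ::
    "('k::field \<Rightarrow> 'h::ring_1 \<Rightarrow> 'h) \<Rightarrow> ('h \<Rightarrow> 'h) \<Rightarrow> ('h \<Rightarrow> 'k) set" where
  "traces scale S =
    {t. Vector_Spaces.linear scale (*) t \<and> (\<forall>x y. t (x * y) = t (y * x)) \<and> (\<forall>x. t (S x) = t x)}"

definition linear_iso_betw ::
    "('k::field \<Rightarrow> 'a::ab_group_add \<Rightarrow> 'a) \<Rightarrow> ('k \<Rightarrow> 'b::ab_group_add \<Rightarrow> 'b) \<Rightarrow>
      ('a \<Rightarrow> 'b) \<Rightarrow> 'a set \<Rightarrow> 'b set \<Rightarrow> bool" where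
  "linear_iso_betw s1 s2 f U V \<longleftrightarrow>
    module.subspace s1 U \<and> module.subspace s2 V \<and>
    (\<forall>x\<in>U. \<forall>y\<in>U. f (x + y) = f x + f y) \<and> (\<forall>r. \<forall>x\<in>U. f (s1 r x) = s2 r (f x)) \<and>
    bij_betw f U V"

end

theory Submission imports Defs begin

text \<open>
  Throughout, \<open>\<lambda>\<close> is the given right integral (written \<open>lam\<close>) and \<open>x\<^sub>1 \<otimes> x\<^sub>2\<close> is Sweedler notation.

  Everything about integrals is derived from the identity
  \<open>\<lambda>(a\<^sub>1 x) a\<^sub>2 = \<lambda>(a x\<^sub>1) S(x\<^sub>2)\<close> (\<open>lam_exchange\<close>).  It implies that \<open>\<epsilon>\<close> vanishes on every \<open>a\<close> with
  \<open>\<lambda>(a -) = 0\<close>; since the dimension is finite, \<open>\<epsilon> = \<lambda>(- \<Lambda>)\<close> for some \<open>\<Lambda>\<close>, and the same identity at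
  \<open>x = \<Lambda>\<close> then shows that the pairing \<open>\<lambda>(x y)\<close> is nondegenerate and that
  \<open>x = \<lambda>(x \<Lambda>\<^sub>1) S(\<Lambda>\<^sub>2)\<close> for all \<open>x\<close> (\<open>Lam_resolution\<close>).  Hence \<open>\<Lambda>\<close> spans the left integrals,
  \<open>\<nu> = \<lambda>(\<Lambda> -)\<close> is the distinguished grouplike element of the dual, \<open>S\<close> is bijective, and every linear
  form is \<open>\<lambda>(zG -)\<close> for exactly one \<open>z\<close>.

  Two more formulas move \<open>z\<close> around inside \<open>\<lambda>\<close>: the Nakayama formula
  \<open>\<lambda>(a x) = \<lambda>(S\<^sup>2(x \<leftharpoonup> \<nu>) a)\<close> (\<open>nakayama\<close>), and \<open>\<lambda>(S(x)) = \<lambda>(g x)\<close> (\<open>lam_S\<close>), where \<open>g\<close> is the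
  element with \<open>x\<^sub>1 \<lambda>(x\<^sub>2) = \<lambda>(x) g\<close>.

  On the braided side, \<open>R\<^sub>2\<^sub>1 R \<Delta>(u) = u \<otimes> u\<close> (\<open>drinfeld_cop\<close>) makes \<open>G = \<theta>u\<close> grouplike with
  \<open>S\<^sup>2(x) = G x G\<^sup>-\<^sup>1\<close>.  Evaluating \<open>R \<Delta>(\<Lambda>) = \<sigma>\<Delta>(\<Lambda>) R\<close> with \<open>\<lambda>\<close> on the second factor gives
  \<open>S(u) g = u h\<^sub>\<nu>\<close> (\<open>drinfeld_hnu\<close>), that is, \<open>g = G\<^sup>2 h\<^sub>\<nu>\<close>.

  Now let \<open>t = \<lambda>(zG -)\<close>.  By the Nakayama formula \<open>t(x y) = t(y x)\<close> holds for all \<open>x\<close>, \<open>y\<close> iff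
  \<open>z S\<^sup>2(x) = (S\<^sup>2(x) \<leftharpoonup> \<nu>) z\<close> for all \<open>x\<close>, that is, \<open>z \<in> L(H)\<close> (\<open>symmetric_iff\<close>).  For such \<open>z\<close>, the
  formula for \<open>\<lambda> \<circ> S\<close> turns \<open>t \<circ> S = t\<close> into \<open>zG = (S(zG) \<leftharpoonup> \<nu>) g\<close>; as \<open>z\<close> and
  \<open>S(z) \<leftharpoonup> \<nu>\<close> commute with \<open>G\<close> up to the scalar \<open>\<nu>(G)\<close>, all powers of \<open>G\<close> cancel and
  \<open>z = (S(z) \<leftharpoonup> \<nu>) h\<^sub>\<nu> = T(z)\<close> remains (\<open>invariant_iff\<close>).
\<close>

section \<open>Sums over tensors\<close>

definition tsum :: "('a \<times> 'b) list \<Rightarrow> ('a \<Rightarrow> 'b \<Rightarrow> 'v::ab_group_add) \<Rightarrow> 'v" where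
  "tsum xs \<beta> = (\<Sum>(a, b)\<leftarrow>xs. \<beta> a b)"

definition tsum3 :: "('a \<times> 'b \<times> 'c) list \<Rightarrow> ('a \<Rightarrow> 'b \<Rightarrow> 'c \<Rightarrow> 'v::ab_group_add) \<Rightarrow> 'v" where
  "tsum3 xs \<gamma> = (\<Sum>(a, b, c)\<leftarrow>xs. \<gamma> a b c)"

lemma tsum_simps [simp]:
  "tsum [] \<beta> = 0"
  "tsum ((a, b) # xs) \<beta> = \<beta> a b + tsum xs \<beta>"
  "tsum (xs @ ys) \<beta> = tsum xs \<beta> + tsum ys \<beta>"
  by (simp_all add: tsum_def)

lemma tsum3_simps [simp]:
  "tsum3 [] \<gamma> = 0"
  "tsum3 ((a, b, c) # xs) \<gamma> = \<gamma> a b c + tsum3 xs \<gamma>"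
  "tsum3 (xs @ ys) \<gamma> = tsum3 xs \<gamma> + tsum3 ys \<gamma>"
  by (simp_all add: tsum3_def)

lemma tsum_zero [simp]: "tsum xs (\<lambda>a b. 0) = 0"
  by (induct xs) auto

lemma tsum_add: "tsum xs (\<lambda>a b. f a b + g a b) = tsum xs f + tsum xs g"
  by (induct xs) (auto simp: algebra_simps)

lemma tsum_swap:
  "tsum xs (\<lambda>a b. tsum ys (\<lambda>c d. F a b c d)) = tsum ys (\<lambda>c d. tsum xs (\<lambda>a b. F a b c d))"
  by (induct xs) (auto simp: tsum_add)

lemma tsum_additive:
  assumes "\<And>x y. f (x + y) = f x + (f y :: 'v::ab_group_add)"
  shows "f (tsum xs \<beta>) = tsum xs (\<lambda>a b. f (\<beta> a b))"
proof -
  have "f 0 = 0"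
    using assms[of 0 0] by simp
  then show ?thesis
    by (induct xs) (auto simp: assms)
qed

lemma tsum_mult_right: "tsum xs \<beta> * y = tsum xs (\<lambda>a b. \<beta> a b * (y :: 'r::ring))"
  by (rule tsum_additive) (rule distrib_right)

lemma tsum_mult_left: "y * tsum xs \<beta> = tsum xs (\<lambda>a b. (y :: 'r::ring) * \<beta> a b)"
  by (rule tsum_additive) (rule distrib_left)

lemma tsum_mult2: "tsum (mult2 xs ys) \<beta> = tsum xs (\<lambda>a b. tsum ys (\<lambda>c d. \<beta> (a * c) (b * d)))"
proof -
  have "tsum (map (\<lambda>(c, d). (a * c, b * d)) ys) \<beta> = tsum ys (\<lambda>c d. \<beta> (a * c) (b * d))" for a b
    by (induct ys) auto
  then show ?thesis
    unfolding mult2_def by (induct xs) auto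
qed

lemma tsum3_mult3:
  "tsum3 (mult3 xs ys) \<gamma> =
    tsum3 xs (\<lambda>a b c. tsum3 ys (\<lambda>a' b' c'. \<gamma> (a * a') (b * b') (c * c')))"
proof -
  have "tsum3 (map (\<lambda>(a', b', c'). (a * a', b * b', c * c')) ys) \<gamma> =
      tsum3 ys (\<lambda>a' b' c'. \<gamma> (a * a') (b * b') (c * c'))" for a b c
    by (induct ys) auto
  then show ?thesis
    unfolding mult3_def by (induct xs) auto
qed

lemma tsum_flip2: "tsum (flip2 xs) \<beta> = tsum xs (\<lambda>a b. \<beta> b a)"
  unfolding flip2_def by (induct xs) auto

lemma tsum3_legs:
  "tsum3 (leg12 xs) \<gamma> = tsum xs (\<lambda>a b. \<gamma> a b 1)"
  "tsum3 (leg13 xs) \<gamma> = tsum xs (\<lambda>a b. \<gamma> a 1 b)"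
  "tsum3 (leg23 xs) \<gamma> = tsum xs (\<lambda>a b. \<gamma> 1 a b)"
  unfolding leg12_def leg13_def leg23_def by (induct xs) auto

lemma tsum3_cop_id: "tsum3 (cop_id \<Delta> xs) \<gamma> = tsum xs (\<lambda>a b. tsum (\<Delta> a) (\<lambda>p q. \<gamma> p q b))"
proof -
  have "tsum3 (map (\<lambda>(p, q). (p, q, b)) ys) \<gamma> = tsum ys (\<lambda>p q. \<gamma> p q b)" for b ys
    by (induct ys) auto
  then show ?thesis
    unfolding cop_id_def by (induct xs) auto
qed

lemma tsum3_id_cop: "tsum3 (id_cop \<Delta> xs) \<gamma> = tsum xs (\<lambda>a b. tsum (\<Delta> b) (\<lambda>p q. \<gamma> a p q))"
proof -
  have "tsum3 (map (\<lambda>(p, q). (a, p, q)) ys) \<gamma> = tsum ys (\<lambda>p q. \<gamma> a p q)" for a ys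
    by (induct ys) auto
  then show ?thesis
    unfolding id_cop_def by (induct xs) auto
qed

text \<open>
  The half of the universal property of tensor products that the proof uses: it turns a law stated
  modulo equality of tensors into an equation between values.
\<close>

lemma formal_sum_cong_sum:
  assumes "formal_sum_cong E xs ys"
    and "\<And>xs ys. E xs ys \<Longrightarrow> sum_list (map f xs) = sum_list (map f ys)"
  shows "sum_list (map f xs) = (sum_list (map f ys) :: 'v::ab_group_add)"
  using assms by (induct rule: formal_sum_cong.induct) (auto simp: algebra_simps)

context hopf_algebra
begin

text \<open>
  Maps \<open>\<beta>\<close> that factor through the tensor square.  The target is an arbitrary abelian group, so that
  the same laws apply to scalar and vector values and to a value that is itself a sum over a tensor.
\<close>

definition balanced :: "('h \<Rightarrow> 'h \<Rightarrow> 'v::ab_group_add) \<Rightarrow> bool" where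
  "balanced \<beta> \<longleftrightarrow>
    (\<forall>a a' b. \<beta> (a + a') b = \<beta> a b + \<beta> a' b) \<and>
    (\<forall>a b b'. \<beta> a (b + b') = \<beta> a b + \<beta> a b') \<and>
    (\<forall>r a b. \<beta> (r *s a) b = \<beta> a (r *s b))"

definition balanced3 :: "('h \<Rightarrow> 'h \<Rightarrow> 'h \<Rightarrow> 'v::ab_group_add) \<Rightarrow> bool" where
  "balanced3 \<gamma> \<longleftrightarrow> (\<forall>c. balanced (\<lambda>a b. \<gamma> a b c)) \<and> (\<forall>a. balanced (\<gamma> a))"

lemma balancedD:
  assumes "balanced \<beta>"
  shows "\<beta> (a + a') b = \<beta> a b + \<beta> a' b" "\<beta> a (b + b') = \<beta> a b + \<beta> a b'"
    "\<beta> (r *s a) b = \<beta> a (r *s b)"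
  using assms by (auto simp: balanced_def)

lemma balanced_zero:
  assumes "balanced \<beta>"
  shows "\<beta> 0 b = 0"
  using balancedD(1)[OF assms, of 0 0 b] by simp

lemma tsum_eqI:
  assumes "tensor2_eq scale xs ys" "balanced \<beta>"
  shows "tsum xs \<beta> = tsum ys \<beta>"
  using assms(1) unfolding tensor2_eq_def tsum_def
  by (rule formal_sum_cong_sum)
    (auto elim!: bilinear_rel.cases simp: balancedD[OF assms(2)] balanced_zero[OF assms(2)])

lemma tsum3_eqI:
  assumes "tensor3_eq scale xs ys" and \<gamma>: "balanced3 \<gamma>"
  shows "tsum3 xs \<gamma> = tsum3 ys \<gamma>"
proof -
  have 1: "balanced (\<lambda>a b. \<gamma> a b c)" and 2: "balanced (\<gamma> a)" for a c
    using \<gamma> by (auto simp: balanced3_def)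
  show ?thesis
    using assms(1) unfolding tensor3_eq_def tsum3_def
    by (rule formal_sum_cong_sum)
      (auto elim!: trilinear_rel.cases simp: balancedD[OF 1] balancedD[OF 2] balanced_zero[OF 1])
qed

lemma S_add: "S (x + y) = S x + S y"
  using antipode_linear by (simp add: Vector_Spaces.linear_iff)

lemma S_scale: "S (r *s x) = r *s S x"
  using antipode_linear by (simp add: Vector_Spaces.linear_iff)

lemma counit_add: "\<epsilon> (x + y) = \<epsilon> x + \<epsilon> y"
  using counit_linear by (simp add: Vector_Spaces.linear_iff)

lemma counit_scale: "\<epsilon> (r *s x) = r * \<epsilon> x"
  using counit_linear by (simp add: Vector_Spaces.linear_iff)

lemma tsum_scale: "r *s tsum xs \<beta> = tsum xs (\<lambda>a b. r *s \<beta> a b)"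
  by (rule tsum_additive) (rule scale_right_distrib)

lemma tsum_cop_add: "balanced \<beta> \<Longrightarrow> tsum (\<Delta> (x + y)) \<beta> = tsum (\<Delta> x) \<beta> + tsum (\<Delta> y) \<beta>"
  using tsum_eqI[OF cop_add] by simp

lemma tsum_cop_scale: "balanced \<beta> \<Longrightarrow> tsum (\<Delta> (r *s x)) \<beta> = tsum (\<Delta> x) (\<lambda>a b. \<beta> (r *s a) b)"
proof -
  have "tsum (map (\<lambda>(a, b). (r *s a, b)) xs) \<beta> = tsum xs (\<lambda>a b. \<beta> (r *s a) b)" for xs
    by (induct xs) auto
  then show "balanced \<beta> \<Longrightarrow> ?thesis"
    using tsum_eqI[OF cop_scale, of \<beta>] by simp
qed

text \<open>
  These rules prove \<open>balanced\<close> side conditions.  They expand sums and products, move \<open>tsum\<close> outside of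
  products and scalar multiples, and pull scalars out of products and linear maps; with the rules of a
  hypothesis \<open>balanced \<beta>\<close>, scalars end up in the last tensor factor.
\<close>

lemmas multilinear_simps = distrib_left distrib_right scale_mult_left scale_mult_right
  scale_right_distrib scale_left_distrib S_add S_scale counit_add counit_scale
  tsum_add tsum_scale tsum_mult_left tsum_mult_right tsum_cop_add tsum_cop_scale
  balanced_def balanced3_def mult_ac

section \<open>Hopf algebra identities in Sweedler form\<close>

lemma tsum_cop_mult:
  "balanced \<beta> \<Longrightarrow>
    tsum (\<Delta> (x * y)) \<beta> = tsum (\<Delta> x) (\<lambda>a b. tsum (\<Delta> y) (\<lambda>c d. \<beta> (a * c) (b * d)))"
  using tsum_eqI[OF cop_mult] by (simp add: tsum_mult2)

lemma tsum_cop_one: "balanced \<beta> \<Longrightarrow> tsum (\<Delta> 1) \<beta> = \<beta> 1 1"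
  using tsum_eqI[OF cop_one] by simp

lemma tsum_coassoc:
  "balanced3 \<gamma> \<Longrightarrow>
    tsum (\<Delta> x) (\<lambda>a b. tsum (\<Delta> a) (\<lambda>p q. \<gamma> p q b)) =
    tsum (\<Delta> x) (\<lambda>a b. tsum (\<Delta> b) (\<lambda>p q. \<gamma> a p q))"
  using tsum3_eqI[OF coassoc] by (simp add: tsum3_cop_id tsum3_id_cop)

lemma tsum_counit_left:
  assumes "\<And>x y. f (x + y) = f x + (f y :: 'v::ab_group_add)"
  shows "tsum (\<Delta> x) (\<lambda>a b. f (\<epsilon> a *s b)) = f x"
  using tsum_additive[of f "\<Delta> x" "\<lambda>a b. \<epsilon> a *s b", OF assms] counit_left by (simp add: tsum_def)

lemma tsum_counit_right:
  assumes "\<And>x y. f (x + y) = f x + (f y :: 'v::ab_group_add)"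
  shows "tsum (\<Delta> x) (\<lambda>a b. f (\<epsilon> b *s a)) = f x"
  using tsum_additive[of f "\<Delta> x" "\<lambda>a b. \<epsilon> b *s a", OF assms] counit_right by (simp add: tsum_def)

lemma tsum_antipode_left:
  assumes "\<And>x y. f (x + y) = f x + (f y :: 'v::ab_group_add)"
  shows "tsum (\<Delta> x) (\<lambda>a b. f (S a * b)) = f (\<epsilon> x *s 1)"
  using tsum_additive[of f "\<Delta> x" "\<lambda>a b. S a * b", OF assms] antipode_left by (simp add: tsum_def)

lemma tsum_antipode_right:
  assumes "\<And>x y. f (x + y) = f x + (f y :: 'v::ab_group_add)"
  shows "tsum (\<Delta> x) (\<lambda>a b. f (a * S b)) = f (\<epsilon> x *s 1)"
  using tsum_additive[of f "\<Delta> x" "\<lambda>a b. a * S b", OF assms] antipode_right by (simp add: tsum_def)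

text \<open>
  Cancelling \<open>S(x\<^sub>1) x\<^sub>2\<close> or \<open>x\<^sub>1 S(x\<^sub>2)\<close> in \<open>x\<^sub>1 \<otimes> x\<^sub>2 \<otimes> x\<^sub>3\<close>, for both ways of nesting the coproducts.
  Having both saves most explicit uses of coassociativity later.
\<close>

lemma cancel_first:
  assumes \<gamma>: "balanced \<gamma>"
  shows "tsum (\<Delta> x) (\<lambda>a b. tsum (\<Delta> a) (\<lambda>p q. \<gamma> (S p * q) b)) = \<gamma> 1 x"
    and "tsum (\<Delta> x) (\<lambda>a b. tsum (\<Delta> a) (\<lambda>p q. \<gamma> (p * S q) b)) = \<gamma> 1 x"
    and "tsum (\<Delta> x) (\<lambda>a b. tsum (\<Delta> b) (\<lambda>p q. \<gamma> (S a * p) q)) = \<gamma> 1 x"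
    and "tsum (\<Delta> x) (\<lambda>a b. tsum (\<Delta> b) (\<lambda>p q. \<gamma> (a * S p) q)) = \<gamma> 1 x"
proof -
  note D = balancedD[OF \<gamma>]
  have e: "tsum (\<Delta> x) (\<lambda>a b. \<gamma> 1 (\<epsilon> a *s b)) = \<gamma> 1 x"
    by (rule tsum_counit_left) (rule D)
  have 1: "tsum (\<Delta> a) (\<lambda>p q. \<gamma> (S p * q) b) = \<gamma> 1 (\<epsilon> a *s b)" for a b
    using tsum_antipode_left[of "\<lambda>s. \<gamma> s b" a] by (simp add: D)
  have 2: "tsum (\<Delta> a) (\<lambda>p q. \<gamma> (p * S q) b) = \<gamma> 1 (\<epsilon> a *s b)" for a b
    using tsum_antipode_right[of "\<lambda>s. \<gamma> s b" a] by (simp add: D)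
  show 3: "tsum (\<Delta> x) (\<lambda>a b. tsum (\<Delta> a) (\<lambda>p q. \<gamma> (S p * q) b)) = \<gamma> 1 x"
    and 4: "tsum (\<Delta> x) (\<lambda>a b. tsum (\<Delta> a) (\<lambda>p q. \<gamma> (p * S q) b)) = \<gamma> 1 x"
    by (simp_all add: 1 2 e)
  show "tsum (\<Delta> x) (\<lambda>a b. tsum (\<Delta> b) (\<lambda>p q. \<gamma> (S a * p) q)) = \<gamma> 1 x"
    using tsum_coassoc[of "\<lambda>a p q. \<gamma> (S a * p) q" x] 3 by (simp add: multilinear_simps D)
  show "tsum (\<Delta> x) (\<lambda>a b. tsum (\<Delta> b) (\<lambda>p q. \<gamma> (a * S p) q)) = \<gamma> 1 x"
    using tsum_coassoc[of "\<lambda>a p q. \<gamma> (a * S p) q" x] 4 by (simp add: multilinear_simps D)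
qed

lemma cancel_last:
  assumes \<gamma>: "balanced \<gamma>"
  shows "tsum (\<Delta> x) (\<lambda>a b. tsum (\<Delta> b) (\<lambda>p q. \<gamma> a (p * S q))) = \<gamma> x 1"
    and "tsum (\<Delta> x) (\<lambda>a b. tsum (\<Delta> a) (\<lambda>p q. \<gamma> p (q * S b))) = \<gamma> x 1"
proof -
  note D = balancedD[OF \<gamma>]
  have e: "tsum (\<Delta> x) (\<lambda>a b. \<gamma> (\<epsilon> b *s a) 1) = \<gamma> x 1"
    by (rule tsum_counit_right) (rule D)
  have 1: "tsum (\<Delta> b) (\<lambda>p q. \<gamma> a (p * S q)) = \<gamma> (\<epsilon> b *s a) 1" for a b
    using tsum_antipode_right[of "\<lambda>s. \<gamma> a s" b] by (simp add: D)
  show 2: "tsum (\<Delta> x) (\<lambda>a b. tsum (\<Delta> b) (\<lambda>p q. \<gamma> a (p * S q))) = \<gamma> x 1"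
    using e by (simp only: 1)
  show "tsum (\<Delta> x) (\<lambda>a b. tsum (\<Delta> a) (\<lambda>p q. \<gamma> p (q * S b))) = \<gamma> x 1"
    using tsum_coassoc[of "\<lambda>a p q. \<gamma> a (p * S q)" x] 2 by (simp add: multilinear_simps D)
qed

lemma S_one [simp]: "S 1 = 1"
  using tsum_antipode_left[of "\<lambda>x. x" 1] tsum_cop_one[of "\<lambda>a b. S a * b"]
  by (simp add: multilinear_simps counit_one)

lemma counit_S: "\<epsilon> (S x) = \<epsilon> x"
proof -
  have "\<epsilon> (S x) = tsum (\<Delta> x) (\<lambda>a b. \<epsilon> (S (\<epsilon> b *s a)))"
    by (rule tsum_counit_right[symmetric]) (simp add: multilinear_simps)
  also have "\<dots> = tsum (\<Delta> x) (\<lambda>a b. \<epsilon> (S a * b))"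
    by (simp add: multilinear_simps counit_mult)
  also have "\<dots> = \<epsilon> x"
    by (subst tsum_antipode_left) (simp_all add: multilinear_simps counit_one)
  finally show ?thesis .
qed

text \<open>
  Both sides are values of \<open>S(y\<^sub>1) S(x\<^sub>1) x\<^sub>2 y\<^sub>2 S(x\<^sub>3 y\<^sub>3)\<close>: cancelling \<open>S(x\<^sub>1) x\<^sub>2\<close> and then \<open>S(y\<^sub>1) y\<^sub>2\<close>
  leaves \<open>S(x y)\<close>, whereas cancelling \<open>x\<^sub>2 y\<^sub>2\<close> against \<open>S(x\<^sub>3 y\<^sub>3)\<close> leaves \<open>S(y) S(x)\<close>.
\<close>

lemma S_mult: "S (x * y) = S y * S x"
proof -
  let ?F = "\<lambda>x1 x2 x3 y1 y2 y3. S y1 * S x1 * (x2 * y2) * S (x3 * y3)"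
  have A: "tsum (\<Delta> y) (\<lambda>y1 y'. tsum (\<Delta> x) (\<lambda>x1 x'. tsum (\<Delta> y') (\<lambda>y2 y3. tsum (\<Delta> x') (\<lambda>x2 x3.
      ?F x1 x2 x3 y1 y2 y3)))) = S (x * y)"
  proof -
    have "tsum (\<Delta> x) (\<lambda>x1 x'. tsum (\<Delta> y') (\<lambda>y2 y3. tsum (\<Delta> x') (\<lambda>x2 x3.
        ?F x1 x2 x3 y1 y2 y3))) = tsum (\<Delta> y') (\<lambda>y2 y3. S y1 * y2 * S (x * y3))" for y1 y'
    proof (subst tsum_swap, rule arg_cong[where f="tsum (\<Delta> y')"], intro ext)
      fix y2 y3
      show "tsum (\<Delta> x) (\<lambda>x1 x'. tsum (\<Delta> x') (\<lambda>x2 x3. ?F x1 x2 x3 y1 y2 y3)) = S y1 * y2 * S (x * y3)"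
        using cancel_first(3)[of "\<lambda>s t. S y1 * s * y2 * S (t * y3)" x]
        by (simp add: multilinear_simps mult.assoc)
    qed
    then show ?thesis
      using cancel_first(3)[of "\<lambda>s t. s * S (x * t)" y] by (simp add: multilinear_simps)
  qed
  have B: "tsum (\<Delta> y') (\<lambda>y2 y3. tsum (\<Delta> x') (\<lambda>x2 x3. ?F x1 x2 x3 y1 y2 y3)) =
      S (\<epsilon> y' *s y1) * S (\<epsilon> x' *s x1)" for x1 x' y1 y'
  proof -
    have "tsum (\<Delta> y') (\<lambda>y2 y3. tsum (\<Delta> x') (\<lambda>x2 x3. ?F x1 x2 x3 y1 y2 y3)) =
        tsum (\<Delta> (x' * y')) (\<lambda>p q. S y1 * S x1 * (p * S q))"
      by (subst tsum_cop_mult, simp add: multilinear_simps, subst tsum_swap)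
        (simp add: mult.assoc)
    also have "\<dots> = S y1 * S x1 * (\<epsilon> (x' * y') *s 1)"
      by (rule tsum_antipode_right) (simp add: multilinear_simps)
    finally show ?thesis
      by (simp add: multilinear_simps counit_mult)
  qed
  have "tsum (\<Delta> y) (\<lambda>y1 y'. tsum (\<Delta> x) (\<lambda>x1 x'. S (\<epsilon> y' *s y1) * S (\<epsilon> x' *s x1))) = S y * S x"
  proof -
    have "tsum (\<Delta> x) (\<lambda>x1 x'. s * S (\<epsilon> x' *s x1)) = s * S x" for s
      by (rule tsum_counit_right) (simp add: multilinear_simps)
    then show ?thesis
      using tsum_counit_right[of "\<lambda>t. S t * S x" y] by (simp add: S_add distrib_right)
  qed
  then show ?thesis
    using A by (simp add: B)
qed

text \<open>
  The tensor
  \<open>(S(x\<^sub>2) \<otimes> S(x\<^sub>1)) (x\<^sub>3 \<otimes> x\<^sub>4) \<Delta>(S(x\<^sub>5))\<close> reduces to \<open>S(x\<^sub>2) \<otimes> S(x\<^sub>1)\<close> because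
  \<open>\<Delta>(x\<^sub>3) \<Delta>(S(x\<^sub>4)) = \<Delta>(x\<^sub>3 S(x\<^sub>4))\<close>, and to \<open>\<Delta>(S(x))\<close> by cancelling \<open>S(x\<^sub>2) x\<^sub>3\<close> and then \<open>S(x\<^sub>1) x\<^sub>4\<close>.
\<close>

lemma tsum_cop_S:
  assumes \<beta>: "balanced \<beta>"
  shows "tsum (\<Delta> (S x)) \<beta> = tsum (\<Delta> x) (\<lambda>a b. \<beta> (S b) (S a))"
proof -
  note D = balancedD[OF \<beta>]
  define \<gamma> where "\<gamma> a y = tsum (\<Delta> y) (\<lambda>s t. tsum (\<Delta> a) (\<lambda>a1 a2. \<beta> (S a2 * s) (S a1 * t)))" for a y
  have \<gamma>: "balanced \<gamma>"
    unfolding \<gamma>_def by (simp add: multilinear_simps D)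
  have "tsum (\<Delta> x) (\<lambda>a b. tsum (\<Delta> b) (\<lambda>c d. \<gamma> a (c * S d))) = \<gamma> x 1"
    by (rule cancel_last(1)[OF \<gamma>])
  also have "\<gamma> x 1 = tsum (\<Delta> x) (\<lambda>a b. \<beta> (S b) (S a))"
    unfolding \<gamma>_def by (subst tsum_cop_one) (simp_all add: multilinear_simps D)
  finally have 1: "tsum (\<Delta> x) (\<lambda>a b. tsum (\<Delta> b) (\<lambda>c d. \<gamma> a (c * S d))) = \<dots>" .
  have 2: "tsum (\<Delta> x) (\<lambda>a b. tsum (\<Delta> b) (\<lambda>c d. \<gamma> a (c * S d))) =
      tsum (\<Delta> x) (\<lambda>y d. tsum (\<Delta> y) (\<lambda>a c. \<gamma> a (c * S d)))"
    by (rule tsum_coassoc[symmetric]) (simp add: multilinear_simps balancedD[OF \<gamma>])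
  define \<eta> where "\<eta> d s t = tsum (\<Delta> (S d)) (\<lambda>s' t'. \<beta> (s * s') (t * t'))" for d s t
  have \<eta>: "balanced (\<eta> d)" for d
    unfolding \<eta>_def by (simp add: multilinear_simps D)
  have \<gamma>\<eta>: "\<gamma> a (c * S d) = tsum (\<Delta> a) (\<lambda>a1 a2. tsum (\<Delta> c) (\<lambda>p q. \<eta> d (S a2 * p) (S a1 * q)))" for a c d
  proof -
    have "\<gamma> a (c * S d) = tsum (\<Delta> c) (\<lambda>p q. tsum (\<Delta> (S d)) (\<lambda>s t. tsum (\<Delta> a) (\<lambda>a1 a2.
        \<beta> (S a2 * (p * s)) (S a1 * (q * t)))))"
      unfolding \<gamma>_def by (rule tsum_cop_mult) (simp add: multilinear_simps D)
    also have "\<dots> = tsum (\<Delta> c) (\<lambda>p q. tsum (\<Delta> a) (\<lambda>a1 a2. \<eta> d (S a2 * p) (S a1 * q)))"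
      unfolding \<eta>_def by (subst tsum_swap) (simp add: mult.assoc)
    finally show ?thesis
      by (simp add: tsum_swap[of "\<Delta> c"])
  qed
  have 3: "tsum (\<Delta> y) (\<lambda>a c. \<gamma> a (c * S d)) = \<eta> d 1 (\<epsilon> y *s 1)" for y d
  proof -
    note E = balancedD[OF \<eta>[of d]]
    have "tsum (\<Delta> y) (\<lambda>a c. \<gamma> a (c * S d)) =
        tsum (\<Delta> y) (\<lambda>a1 w. tsum (\<Delta> w) (\<lambda>a2 c. tsum (\<Delta> c) (\<lambda>p q. \<eta> d (S a2 * p) (S a1 * q))))"
      unfolding \<gamma>\<eta> by (rule tsum_coassoc) (simp add: multilinear_simps E)
    also have "\<dots> = tsum (\<Delta> y) (\<lambda>a1 w. \<eta> d 1 (S a1 * w))"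
    proof -
      have "tsum (\<Delta> w) (\<lambda>a2 c. tsum (\<Delta> c) (\<lambda>p q. \<eta> d (S a2 * p) (S a1 * q))) = \<eta> d 1 (S a1 * w)"
        for a1 w
        by (rule cancel_first(3)[where \<gamma>="\<lambda>s q. \<eta> d s (S a1 * q)"]) (simp add: multilinear_simps E)
      then show ?thesis by simp
    qed
    also have "\<dots> = \<eta> d 1 (\<epsilon> y *s 1)"
      by (rule tsum_antipode_left) (rule E)
    finally show ?thesis .
  qed
  have "tsum (\<Delta> x) (\<lambda>y d. \<eta> d 1 (\<epsilon> y *s 1)) = tsum (\<Delta> x) (\<lambda>y d. tsum (\<Delta> (S (\<epsilon> y *s d))) \<beta>)"
    unfolding \<eta>_def by (simp add: multilinear_simps D \<beta>)
  also have "\<dots> = tsum (\<Delta> (S x)) \<beta>"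
    by (rule tsum_counit_left) (simp add: S_add tsum_cop_add \<beta>)
  finally show ?thesis
    using 1 2 3 by simp
qed

end

section \<open>Nondegenerate pairings in finite dimension\<close>

lemma vector_space_field: "vector_space ((*) :: 'k::field \<Rightarrow> 'k \<Rightarrow> 'k)"
  by unfold_locales (simp_all add: algebra_simps)

context finite_dimensional_vector_space
begin

lemma sum_coordinates: "(\<Sum>b\<in>Basis. representation Basis v b *s b) = v"
  by (rule sum_representation_eq) (simp_all add: independent_Basis span_Basis finite_Basis)

text \<open>
  The map \<open>L\<close> reads the form \<open>\<beta> x\<close> as a coordinate vector.  This identifies the dual space with the space
  itself, so that injectivity and surjectivity become equivalent.
\<close>

lemma nondegenerate_pairing:
  fixes \<beta> :: "'b \<Rightarrow> 'b \<Rightarrow> 'a"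
  assumes linear_left: "\<And>y. Vector_Spaces.linear scale (*) (\<lambda>x. \<beta> x y)"
    and linear_right: "\<And>x. Vector_Spaces.linear scale (*) (\<beta> x)"
    and nondegenerate: "\<And>x. (\<And>y. \<beta> x y = 0) \<Longrightarrow> x = 0"
  shows representable: "Vector_Spaces.linear scale (*) t \<Longrightarrow> \<exists>x. \<beta> x = t"
    and nondegenerate_right: "(\<And>x. \<beta> x y = 0) \<Longrightarrow> y = 0"
proof -
  define L where "L x = (\<Sum>b\<in>Basis. \<beta> x b *s b)" for x
  note l = linear_left[unfolded Vector_Spaces.linear_iff]
  have expand: "t y = (\<Sum>b\<in>Basis. representation Basis y b * t b)"
    if "Vector_Spaces.linear scale (*) t" for t y
  proof -
    interpret t: Vector_Spaces.linear scale "(*)" t by fact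
    have "t y = t (\<Sum>b\<in>Basis. representation Basis y b *s b)"
      by (simp add: sum_coordinates)
    then show ?thesis
      by (simp add: t.sum t.scale)
  qed
  have linL: "Vector_Spaces.linear scale scale L"
    unfolding L_def using l
    by (simp add: Vector_Spaces.linear_iff vector_space_axioms scale_left_distrib sum.distrib
        scale_sum_right)
  have coord: "representation Basis (\<Sum>b\<in>Basis. c b *s b) b = c b" if "b \<in> Basis" for c b
  proof -
    have "(\<Sum>b\<in>Basis. (representation Basis (\<Sum>b\<in>Basis. c b *s b) b - c b) *s b) = 0"
      by (simp add: scale_left_diff_distrib sum_subtractf sum_coordinates)
    then show ?thesis
      using independentD[OF independent_Basis finite_Basis subset_refl _ that,
          of "\<lambda>b. representation Basis (\<Sum>b\<in>Basis. c b *s b) b - c b"] by simp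
  qed
  have "inj L"
    unfolding module_hom.inj_iff_eq_0[OF linL[unfolded linear_iff_module_hom]]
  proof (intro allI impI)
    fix x assume "L x = 0"
    then have "\<beta> x b = 0" if "b \<in> Basis" for b
      using independentD[OF independent_Basis finite_Basis subset_refl _ that, of "\<beta> x"]
      by (simp add: L_def)
    then have "\<beta> x y = 0" for y
      using expand[OF linear_right, of x y] by simp
    then show "x = 0"
      by (rule nondegenerate)
  qed
  then have surj: "surj L"
    by (rule linear_inj_imp_surj[OF linL])
  have rep: "\<exists>x. \<beta> x = t" if t: "Vector_Spaces.linear scale (*) t" for t
  proof -
    obtain x where "L x = (\<Sum>b\<in>Basis. t b *s b)"
      using surj by (metis surj_def)
    then have "\<beta> x b = t b" if "b \<in> Basis" for b
      using coord[OF that, of "\<beta> x"] coord[OF that, of t] by (simp add: L_def)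
    then have "\<beta> x y = t y" for y
      using expand[OF linear_right, of x y] expand[OF t, of y] by simp
    then show ?thesis by auto
  qed
  show "Vector_Spaces.linear scale (*) t \<Longrightarrow> \<exists>x. \<beta> x = t"
    by (rule rep)
  show "y = 0" if 0: "\<And>x. \<beta> x y = 0"
  proof -
    have "representation Basis y b = 0" if "b \<in> Basis" for b
    proof -
      have "Vector_Spaces.linear scale (*) (\<lambda>y. representation Basis y b)"
        by (simp add: Vector_Spaces.linear_iff vector_space_axioms
            vector_space_field
            representation_add representation_scale independent_Basis span_Basis)
      from rep[OF this] 0 show ?thesis by metis
    qed
    then show ?thesis
      using sum_coordinates[of y] by simp
  qed
qed

end

section \<open>Integrals\<close>

locale hopf_integral = hopf_algebra scale \<Delta> \<epsilon> S + finite_dimensional_vector_space scale Basis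
  for scale :: "'k::field \<Rightarrow> 'h::ring_1 \<Rightarrow> 'h" (infixr \<open>*s\<close> 75)
    and \<Delta> :: "'h \<Rightarrow> ('h \<times> 'h) list"
    and \<epsilon> :: "'h \<Rightarrow> 'k"
    and S :: "'h \<Rightarrow> 'h"
    and Basis :: "'h set" +
  fixes lam :: "'h \<Rightarrow> 'k"
  assumes right_integral: "right_integral_dual scale \<Delta> lam"
    and lam_nonzero: "lam \<noteq> 0"
begin

lemma lam_linear: "Vector_Spaces.linear scale (*) lam"
  using right_integral by (simp add: right_integral_dual_def)

lemma lam_add: "lam (x + y) = lam x + lam y"
  using lam_linear by (simp add: Vector_Spaces.linear_iff)

lemma lam_scale: "lam (r *s x) = r * lam x"
  using lam_linear by (simp add: Vector_Spaces.linear_iff)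

lemma lam_zero: "lam 0 = 0"
  using lam_scale[of 0 0] by simp

lemma lam_integral: "tsum (\<Delta> x) (\<lambda>a b. lam a *s b) = lam x *s 1"
  using right_integral by (simp add: right_integral_dual_def tsum_def)

lemmas lam_simps = multilinear_simps lam_add lam_scale

lemma lam_tsum: "lam (tsum xs \<beta>) = tsum xs (\<lambda>a b. lam (\<beta> a b))"
  by (rule tsum_additive) (rule lam_add)

lemma S_tsum: "S (tsum xs \<beta>) = tsum xs (\<lambda>a b. S (\<beta> a b))"
  by (rule tsum_additive) (rule S_add)

lemma tsum_scale_left: "tsum xs \<beta> *s v = tsum xs (\<lambda>a b. \<beta> a b *s v)"
  by (rule tsum_additive) (rule scale_left_distrib)

text \<open>
  Insert \<open>x\<^sub>2 S(x\<^sub>3)\<close> to the right of \<open>a\<^sub>2\<close>, then apply the integral property to the product \<open>a x\<close>.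
\<close>

lemma lam_exchange:
  "tsum (\<Delta> a) (\<lambda>p q. lam (p * x) *s q) = tsum (\<Delta> x) (\<lambda>y z. lam (a * y) *s S z)"
proof -
  have "tsum (\<Delta> a) (\<lambda>a1 a2. lam (a1 * x) *s a2) =
      tsum (\<Delta> a) (\<lambda>a1 a2. tsum (\<Delta> x) (\<lambda>y z. tsum (\<Delta> y) (\<lambda>p q. lam (a1 * p) *s (a2 * (q * S z)))))"
  proof -
    have "tsum (\<Delta> x) (\<lambda>y z. tsum (\<Delta> y) (\<lambda>p q. lam (a1 * p) *s (a2 * (q * S z)))) = lam (a1 * x) *s a2"
      for a1 a2
      using cancel_last(2)[of "\<lambda>s t. lam (a1 * s) *s (a2 * t)" x] by (simp add: lam_simps)
    then show ?thesis by simp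
  qed
  also have "\<dots> = tsum (\<Delta> x) (\<lambda>y z. tsum (\<Delta> a) (\<lambda>a1 a2. tsum (\<Delta> y) (\<lambda>p q. lam (a1 * p) *s (a2 * (q * S z)))))"
    by (rule tsum_swap)
  also have "\<dots> = tsum (\<Delta> x) (\<lambda>y z. lam (a * y) *s S z)"
  proof -
    have "tsum (\<Delta> a) (\<lambda>a1 a2. tsum (\<Delta> y) (\<lambda>p q. lam (a1 * p) *s (a2 * (q * S z)))) = lam (a * y) *s S z"
      for y z
    proof -
      have "tsum (\<Delta> a) (\<lambda>a1 a2. tsum (\<Delta> y) (\<lambda>p q. lam (a1 * p) *s (a2 * (q * S z)))) =
          tsum (\<Delta> (a * y)) (\<lambda>s t. lam s *s (t * S z))"
        by (subst tsum_cop_mult) (simp_all add: lam_simps mult.assoc)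
      also have "\<dots> = tsum (\<Delta> (a * y)) (\<lambda>s t. lam s *s t) * S z"
        by (simp add: tsum_mult_right scale_mult_left)
      finally show ?thesis
        by (simp add: lam_integral scale_mult_left)
    qed
    then show ?thesis by simp
  qed
  finally show ?thesis .
qed

lemma lam_pairing_linear:
  "Vector_Spaces.linear scale (*) (\<lambda>x. lam (x * y))" "Vector_Spaces.linear scale (*) (\<lambda>y. lam (x * y))"
  by (simp_all add: Vector_Spaces.linear_iff vector_space_axioms
      vector_space_field lam_simps)

text \<open>
  The hypothesis concerns a fixed argument \<open>x\<close>.  Expanding \<open>L q\<close> in the basis allows an argument that
  depends linearly on the second factor.
\<close>

lemma tensor_pairing:
  assumes "\<And>x. tsum xs (\<lambda>p q. lam (p * x) *s q) = 0"
    and L: "Vector_Spaces.linear scale scale L"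
  shows "tsum xs (\<lambda>p q. lam (p * L q)) = 0"
proof -
  let ?r = "representation Basis"
  have Ladd: "L (x + y) = L x + L y" and Lscale: "L (r *s x) = r *s L x" for x y r
    using L by (simp_all add: Vector_Spaces.linear_iff)
  have radd: "?r (L (x + y)) b = ?r (L x) b + ?r (L y) b"
    and rscale: "?r (L (r *s x)) b = r * ?r (L x) b" for x y b r
    by (simp_all add: Ladd Lscale representation_add representation_scale independent_Basis span_Basis)
  have 0: "tsum xs (\<lambda>p q. lam (p * b) * ?r (L q) b) = 0" for b
  proof -
    have "tsum xs (\<lambda>p q. lam (p * b) * ?r (L q) b) = ?r (L (tsum xs (\<lambda>p q. lam (p * b) *s q))) b"
      by (subst tsum_additive[where f="\<lambda>x. ?r (L x) b"]) (simp_all add: radd rscale)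
    also have "\<dots> = ?r (L (0 *s 0)) b"
      by (simp add: assms(1))
    also have "\<dots> = 0"
      by (simp only: rscale mult_zero_left)
    finally show ?thesis .
  qed
  have "lam (p * L q) = (\<Sum>b\<in>Basis. lam (p * b) * ?r (L q) b)" for p q
  proof -
    interpret Vector_Spaces.linear scale "(*)" "\<lambda>y. lam (p * y)"
      by (rule lam_pairing_linear)
    have "lam (p * L q) = lam (p * (\<Sum>b\<in>Basis. ?r (L q) b *s b))"
      by (simp add: sum_coordinates)
    also have "\<dots> = (\<Sum>b\<in>Basis. lam (p * b) * ?r (L q) b)"
      by (subst sum) (simp add: scale mult.commute)
    finally show ?thesis .
  qed
  then have "tsum xs (\<lambda>p q. lam (p * L q)) = tsum xs (\<lambda>p q. \<Sum>b\<in>Basis. lam (p * b) * ?r (L q) b)"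
    by simp
  also have "\<dots> = (\<Sum>b\<in>Basis. tsum xs (\<lambda>p q. lam (p * b) * ?r (L q) b))"
    by (induct xs) (auto simp: sum.distrib)
  finally show ?thesis by (simp add: 0)
qed

text \<open>
  By \<open>lam_exchange\<close> the hypothesis propagates to \<open>\<lambda>(a\<^sub>1 x) a\<^sub>2 = 0\<close>, and so
  \<open>0 = \<lambda>(a\<^sub>1 S(a\<^sub>2) y) = \<epsilon>(a) \<lambda>(y)\<close>, where \<open>y\<close> can be chosen with \<open>\<lambda>(y) \<noteq> 0\<close>.
\<close>

lemma counit_vanishes:
  assumes "\<And>x. lam (a * x) = 0"
  shows "\<epsilon> a = 0"
proof -
  obtain y where y: "lam y \<noteq> 0"
    using lam_nonzero by (auto simp: fun_eq_iff)
  have "tsum (\<Delta> a) (\<lambda>p q. lam (p * x) *s q) = 0" for x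
    by (simp add: lam_exchange assms)
  moreover have "Vector_Spaces.linear scale scale (\<lambda>q. S q * y)"
    by (simp add: Vector_Spaces.linear_iff vector_space_axioms multilinear_simps)
  ultimately have "tsum (\<Delta> a) (\<lambda>p q. lam (p * (S q * y))) = 0"
    by (rule tensor_pairing)
  moreover have "tsum (\<Delta> a) (\<lambda>p q. lam (p * S q * y)) = lam (\<epsilon> a *s 1 * y)"
    by (rule tsum_antipode_right) (simp add: lam_simps)
  ultimately show ?thesis
    using y by (simp add: lam_simps mult.assoc)
qed

text \<open>
  The kernel of \<open>L\<close> consists of the \<open>a\<close> with \<open>\<lambda>(a -) = 0\<close>, on which \<open>\<epsilon>\<close> vanishes.  Hence \<open>\<epsilon>\<close> factors
  through \<open>L\<close>, as \<open>(\<epsilon> \<circ> g) \<circ> L\<close> with \<open>g\<close> a section of \<open>L\<close> over its range, and is a linear combination of the forms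
  \<open>\<lambda>(- b)\<close> with \<open>b\<close> in the basis.
\<close>

lemma exists_integral: "\<exists>\<Lambda>. \<forall>a. lam (a * \<Lambda>) = \<epsilon> a"
proof -
  interpret vector_space_pair scale scale by unfold_locales
  define L where "L a = (\<Sum>b\<in>Basis. lam (a * b) *s b)" for a
  have linL: "Vector_Spaces.linear scale scale L"
    unfolding L_def
    by (simp add: Vector_Spaces.linear_iff vector_space_axioms lam_simps sum.distrib scale_sum_right)
  obtain g where g: "Vector_Spaces.linear scale scale g" and Lg: "\<And>a. L (g (L a)) = L a"
    using linear_exists_right_inverse_on[OF linL subspace_UNIV] by auto
  interpret g: Vector_Spaces.linear scale scale g by fact
  define \<Lambda> where "\<Lambda> = (\<Sum>b\<in>Basis. \<epsilon> (g b) *s b)"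
  interpret e: Vector_Spaces.linear scale "(*)" \<epsilon> by (rule counit_linear)
  have "lam (a * \<Lambda>) = \<epsilon> a" for a
  proof -
    interpret l: Vector_Spaces.linear scale "(*)" "\<lambda>y. lam (c * y)" for c
      by (rule lam_pairing_linear)
    have L0: "lam (a * x) = 0" if "L a = 0" for a x
    proof -
      have "lam (a * b) = 0" if "b \<in> Basis" for b
        using independentD[OF independent_Basis finite_Basis subset_refl _ that, of "\<lambda>b. lam (a * b)"]
          \<open>L a = 0\<close> by (simp add: L_def)
      moreover have "lam (a * x) = (\<Sum>b\<in>Basis. representation Basis x b * lam (a * b))"
        using l.sum[of a "\<lambda>b. representation Basis x b *s b" Basis]
        by (simp add: sum_coordinates l.scale)
      ultimately show ?thesis by simp
    qed
    have "L (a - g (L a)) = 0"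
      using Lg module_hom.diff[OF linL[unfolded linear_iff_module_hom]] by simp
    then have "\<epsilon> (a - g (L a)) = 0"
      by (intro counit_vanishes L0)
    then have "\<epsilon> a = \<epsilon> (g (L a))"
      by (simp add: e.diff)
    also have "\<dots> = (\<Sum>b\<in>Basis. lam (a * b) * \<epsilon> (g b))"
      by (simp add: L_def g.sum e.sum g.scale e.scale)
    also have "\<dots> = lam (a * \<Lambda>)"
      unfolding \<Lambda>_def by (subst l.sum) (simp add: l.scale mult.commute)
    finally show ?thesis ..
  qed
  then show ?thesis by blast
qed

definition Lam :: 'h ("\<Lambda>") where
  "\<Lambda> = (SOME z. \<forall>a. lam (a * z) = \<epsilon> a)"

lemma lam_Lam: "lam (a * \<Lambda>) = \<epsilon> a"
  using someI_ex[OF exists_integral] unfolding Lam_def by blast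

text \<open>
  At \<open>x = \<Lambda>\<close> the left side of \<open>lam_exchange\<close> is \<open>\<epsilon>(a\<^sub>1) a\<^sub>2 = a\<close>, and the right side depends only on
  \<open>\<lambda>(a -)\<close>.
\<close>

lemma lam_nondegenerate_left:
  assumes "\<And>x. lam (a * x) = 0"
  shows "a = 0"
proof -
  have "a = tsum (\<Delta> a) (\<lambda>p q. \<epsilon> p *s q)"
    by (rule tsum_counit_left[symmetric]) simp
  also have "\<dots> = tsum (\<Delta> \<Lambda>) (\<lambda>y z. lam (a * y) *s S z)"
    by (simp add: lam_exchange[symmetric] lam_Lam)
  finally show ?thesis
    by (simp add: assms)
qed

lemma lam_representable:
  assumes "Vector_Spaces.linear scale (*) t"
  shows "\<exists>z. \<forall>x. lam (z * x) = t x"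
  using representable[of "\<lambda>x y. lam (x * y)", OF lam_pairing_linear lam_nondegenerate_left assms]
  by metis

lemma lam_nondegenerate_right:
  assumes "\<And>x. lam (x * y) = 0"
  shows "y = 0"
  using nondegenerate_right[of "\<lambda>x y. lam (x * y)", OF lam_pairing_linear lam_nondegenerate_left assms]
  by metis

lemma lam_eqI_left: "(\<And>x. lam (a * x) = lam (b * x)) \<Longrightarrow> a = b"
  using lam_nondegenerate_left[of "a - b"]
    module_hom.diff[OF lam_linear[unfolded linear_iff_module_hom]]
  by (simp add: left_diff_distrib)

lemma lam_eqI_right: "(\<And>x. lam (x * a) = lam (x * b)) \<Longrightarrow> a = b"
  using lam_nondegenerate_right[of "a - b"]
    module_hom.diff[OF lam_linear[unfolded linear_iff_module_hom]]
  by (simp add: right_diff_distrib)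

lemma left_integral_Lam: "x * \<Lambda> = \<epsilon> x *s \<Lambda>"
  by (rule lam_eqI_right)
    (simp add: lam_Lam counit_mult lam_simps flip: mult.assoc)

lemma left_integral_unique:
  assumes "left_integral scale \<epsilon> \<Lambda>'"
  shows "\<Lambda>' = lam \<Lambda>' *s \<Lambda>"
  using assms by (intro lam_eqI_right) (simp add: left_integral_def lam_Lam lam_simps)

definition nu :: "'h \<Rightarrow> 'k" ("\<nu>") where
  "\<nu> x = lam (\<Lambda> * x)"

lemma nu_add: "\<nu> (x + y) = \<nu> x + \<nu> y" and nu_scale: "\<nu> (r *s x) = r * \<nu> x"
  by (simp_all add: nu_def lam_simps)

lemma Lam_mult: "\<Lambda> * x = \<nu> x *s \<Lambda>"
  unfolding nu_def
  by (rule left_integral_unique)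
    (simp add: left_integral_def left_integral_Lam scale_mult_left flip: mult.assoc)

lemma nu_one: "\<nu> 1 = 1"
  using lam_Lam[of 1] by (simp add: nu_def counit_one)

lemma nu_mult: "\<nu> (x * y) = \<nu> x * \<nu> y"
proof -
  have "\<Lambda> * (x * y) = \<nu> x *s (\<nu> y *s \<Lambda>)"
    by (simp add: Lam_mult scale_mult_left flip: mult.assoc)
  then show ?thesis
    using lam_Lam[of 1] by (simp add: nu_def[of "x * y"] lam_scale counit_one)
qed

lemma distinguished_grouplike_eq: "distinguished_grouplike scale \<epsilon> = \<nu>"
  unfolding distinguished_grouplike_def
proof (rule the_equality)
  have "z * x = \<nu> x *s z" if "left_integral scale \<epsilon> z" for z x
    by (subst (1 2) left_integral_unique[OF that]) (simp add: scale_mult_left Lam_mult mult.commute)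
  then show "Vector_Spaces.linear scale (*) \<nu> \<and> \<nu> 1 = 1 \<and> (\<forall>x y. \<nu> (x * y) = \<nu> x * \<nu> y) \<and>
      (\<forall>z. left_integral scale \<epsilon> z \<longrightarrow> (\<forall>x. z * x = \<nu> x *s z))"
    by (simp add: Vector_Spaces.linear_iff vector_space_axioms
      vector_space_field nu_add nu_scale nu_one nu_mult)
next
  fix \<nu>'
  assume "Vector_Spaces.linear scale (*) \<nu>' \<and> \<nu>' 1 = 1 \<and> (\<forall>x y. \<nu>' (x * y) = \<nu>' x * \<nu>' y) \<and>
      (\<forall>z. left_integral scale \<epsilon> z \<longrightarrow> (\<forall>x. z * x = \<nu>' x *s z))"
  then have "\<Lambda> * x = \<nu>' x *s \<Lambda>" for x
    by (simp add: left_integral_def left_integral_Lam)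
  then show "\<nu>' = \<nu>"
    using lam_Lam[of 1] by (auto simp: nu_def lam_scale counit_one)
qed

text \<open>
  A dual-basis formula for \<open>\<lambda>\<close>.  It exhibits \<open>x\<close> as a value of \<open>S\<close>, which is why \<open>S\<close> is bijective.
\<close>

lemma Lam_resolution: "tsum (\<Delta> \<Lambda>) (\<lambda>a b. lam (x * a) *s S b) = x"
  by (simp add: lam_exchange[symmetric] lam_Lam tsum_counit_left[of "\<lambda>x. x"])

lemma S_inj: "S x = S y \<Longrightarrow> x = y"
  and S_surj: "\<exists>y. S y = x"
proof -
  have ex: "\<exists>y. S y = x" for x
    using Lam_resolution[of x]
    by (intro exI[of _ "tsum (\<Delta> \<Lambda>) (\<lambda>a b. lam (x * a) *s b)"]) (simp add: S_tsum S_scale)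
  then show "\<exists>y. S y = x" .
  have "surj S" using ex by (metis surjI)
  then have "inj S" by (rule linear_surj_imp_inj[OF antipode_linear])
  then show "S x = S y \<Longrightarrow> x = y" by (simp add: inj_eq)
qed

text \<open>
  If \<open>\<lambda>(z -) = \<lambda>(- x)\<close>, then \<open>Lam_resolution\<close> for \<open>z\<close> reads
  \<open>z = \<lambda>(\<Lambda>\<^sub>1 x) S(\<Lambda>\<^sub>2)\<close>, and \<open>lam_exchange\<close> at \<open>a = \<Lambda>\<close> evaluates this.
\<close>

lemma nakayama: "lam (a * x) = lam (S (S (tsum (\<Delta> x) (\<lambda>y z. \<nu> y *s z))) * a)"
proof -
  obtain z where z: "\<And>a. lam (z * a) = lam (a * x)"
    using lam_representable[OF lam_pairing_linear(1)[of x]] by metis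
  have "z = tsum (\<Delta> \<Lambda>) (\<lambda>p q. lam (p * x) *s S q)"
    by (subst Lam_resolution[symmetric]) (simp add: z)
  also have "\<dots> = S (tsum (\<Delta> \<Lambda>) (\<lambda>p q. lam (p * x) *s q))"
    by (simp add: S_tsum S_scale)
  also have "\<dots> = S (S (tsum (\<Delta> x) (\<lambda>y z. \<nu> y *s z)))"
    by (simp add: lam_exchange nu_def S_tsum S_scale)
  finally show ?thesis
    using z[of a] by simp
qed

text \<open>
  Because \<open>S\<close> is injective and reverses coproducts, composing with it turns a right integral into a left
  integral.
\<close>

lemma lam_S_integral: "tsum (\<Delta> y) (\<lambda>a b. lam (S b) *s a) = lam (S y) *s 1"
proof (rule S_inj)
  have "S (tsum (\<Delta> y) (\<lambda>a b. lam (S b) *s a)) = tsum (\<Delta> (S y)) (\<lambda>p q. lam p *s q)"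
    by (subst tsum_cop_S) (simp_all add: S_tsum lam_simps)
  then show "S (tsum (\<Delta> y) (\<lambda>a b. lam (S b) *s a)) = S (lam (S y) *s 1)"
    by (simp add: lam_integral S_scale)
qed

text \<open>
  The distinguished grouplike element of the Hopf algebra, as the value at \<open>S(\<Lambda>)\<close> of the map
  \<open>x \<mapsto> x\<^sub>1 \<lambda>(x\<^sub>2)\<close>; recall that \<open>\<lambda>(S(\<Lambda>)) = 1\<close> by \<open>lam_S_Lam\<close> below.
\<close>

definition modular :: 'h ("\<g>") where
  "\<g> = tsum (\<Delta> \<Lambda>) (\<lambda>a b. lam (S a) *s S b)"

text \<open>
  Apply \<open>x \<mapsto> x\<^sub>1 \<lambda>(x\<^sub>2)\<close> to \<open>Lam_resolution\<close>.  The resulting \<open>\<lambda>(x \<Lambda>\<^sub>1) \<lambda>(S(\<Lambda>\<^sub>2)) S(\<Lambda>\<^sub>3)\<close> collapses because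
  \<open>\<lambda> \<circ> S\<close> is a left integral.
\<close>

lemma lam_left: "tsum (\<Delta> x) (\<lambda>a b. lam b *s a) = lam x *s \<g>"
proof -
  let ?P = "\<lambda>x. tsum (\<Delta> x) (\<lambda>a b. lam b *s a)"
  have bal: "balanced (\<lambda>a b. lam b *s a)"
    by (simp add: lam_simps)
  have add: "?P (x + y) = ?P x + ?P y" for x y
    by (rule tsum_cop_add[OF bal])
  have scale: "?P (r *s x) = r *s ?P x" for r x
    by (simp add: tsum_cop_scale[OF bal] lam_simps)
  have PS: "?P (S y) = tsum (\<Delta> y) (\<lambda>a b. lam (S a) *s S b)" for y
    by (rule tsum_cop_S[OF bal])
  have "?P x = ?P (tsum (\<Delta> \<Lambda>) (\<lambda>a b. lam (x * a) *s S b))"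
    by (simp add: Lam_resolution)
  also have "\<dots> = tsum (\<Delta> \<Lambda>) (\<lambda>a b. lam (x * a) *s ?P (S b))"
    by (subst tsum_additive[where f="?P"]) (simp_all add: add scale)
  also have "\<dots> = tsum (\<Delta> \<Lambda>) (\<lambda>a b. tsum (\<Delta> b) (\<lambda>p q. lam (x * a) *s lam (S p) *s S q))"
    by (simp only: PS tsum_scale)
  also have "\<dots> = tsum (\<Delta> \<Lambda>) (\<lambda>c q. tsum (\<Delta> c) (\<lambda>a p. lam (x * a) *s lam (S p) *s S q))"
    by (rule tsum_coassoc[symmetric]) (simp add: lam_simps)
  also have "\<dots> = tsum (\<Delta> \<Lambda>) (\<lambda>c q. lam x *s lam (S c) *s S q)"
  proof -
    have "tsum (\<Delta> c) (\<lambda>a p. lam (x * a) *s lam (S p) *s S q) = lam x *s lam (S c) *s S q" for c q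
    proof -
      have "tsum (\<Delta> c) (\<lambda>a p. lam (x * a) *s lam (S p) *s S q) =
          lam (x * tsum (\<Delta> c) (\<lambda>a p. lam (S p) *s a)) *s S q"
        by (simp add: tsum_mult_left lam_tsum tsum_scale_left lam_scale scale_mult_right mult.commute)
      then show ?thesis
        by (simp add: lam_S_integral lam_simps)
    qed
    then show ?thesis by simp
  qed
  finally show ?thesis
    by (simp add: modular_def tsum_scale)
qed

lemma lam_S_Lam: "lam (S \<Lambda>) = 1"
proof -
  obtain x where x: "lam x \<noteq> 0"
    using lam_nonzero by (auto simp: fun_eq_iff)
  have "lam x = lam (tsum (\<Delta> \<Lambda>) (\<lambda>a b. lam (x * a) *s S b))"
    by (simp add: Lam_resolution)
  also have "\<dots> = lam (x * tsum (\<Delta> \<Lambda>) (\<lambda>a b. lam (S b) *s a))"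
    by (simp add: tsum_mult_left lam_tsum lam_scale scale_mult_right mult.commute)
  also have "\<dots> = lam x * lam (S \<Lambda>)"
    by (simp add: lam_S_integral lam_simps)
  finally show ?thesis
    using x by simp
qed

lemma modular_S: "S \<g> * \<g> = 1" "\<g> * S \<g> = 1"
proof -
  obtain x where x: "lam x = 1"
    using lam_Lam[of 1] counit_one by metis
  have tail: "tsum (\<Delta> b) (\<lambda>p q. lam q *s p) = lam b *s \<g>" for b
    by (rule lam_left)
  have "S (tsum (\<Delta> x) (\<lambda>a b. lam b *s a)) * \<g> = tsum (\<Delta> x) (\<lambda>a b. S a * (lam b *s \<g>))"
    by (simp add: S_tsum S_scale tsum_mult_right scale_mult_left scale_mult_right)
  also have "\<dots> = tsum (\<Delta> x) (\<lambda>a b. tsum (\<Delta> b) (\<lambda>p q. lam q *s (S a * p)))"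
    by (simp add: tsum_mult_left scale_mult_right flip: tail)
  also have "\<dots> = lam x *s 1"
    by (rule cancel_first(3)[where \<gamma>="\<lambda>s q. lam q *s s"]) (simp add: lam_simps)
  finally show "S \<g> * \<g> = 1"
    by (simp add: lam_left x)
  have "tsum (\<Delta> x) (\<lambda>a b. lam b *s a) * S \<g> = tsum (\<Delta> x) (\<lambda>a b. a * S (lam b *s \<g>))"
    by (simp add: S_scale tsum_mult_right scale_mult_left scale_mult_right)
  also have "\<dots> = tsum (\<Delta> x) (\<lambda>a b. tsum (\<Delta> b) (\<lambda>p q. lam q *s (a * S p)))"
    by (simp add: tsum_mult_left S_tsum S_scale scale_mult_right flip: tail)
  also have "\<dots> = lam x *s 1"
    by (rule cancel_first(4)[where \<gamma>="\<lambda>s q. lam q *s s"]) (simp add: lam_simps)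
  finally show "\<g> * S \<g> = 1"
    by (simp add: lam_left x)
qed

text \<open>
  The mirror image of \<open>lam_exchange\<close>: insert \<open>S(b\<^sub>1) b\<^sub>2\<close> and apply \<open>lam_left\<close> to \<open>b x\<close>.
\<close>

lemma lam_left_exchange:
  "tsum (\<Delta> x) (\<lambda>p q. lam (b * q) *s p) = tsum (\<Delta> b) (\<lambda>c d. lam (d * x) *s (S c * \<g>))"
proof -
  have "tsum (\<Delta> b) (\<lambda>c d. lam (d * x) *s (S c * \<g>)) =
      tsum (\<Delta> b) (\<lambda>c d. S c * tsum (\<Delta> (d * x)) (\<lambda>p q. lam q *s p))"
    by (simp add: lam_left scale_mult_right)
  also have "\<dots> = tsum (\<Delta> b) (\<lambda>c d. tsum (\<Delta> d) (\<lambda>s t. tsum (\<Delta> x) (\<lambda>p q. lam (t * q) *s (S c * s * p))))"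
    by (subst tsum_cop_mult) (simp_all add: lam_simps mult.assoc)
  also have "\<dots> = tsum (\<Delta> x) (\<lambda>p q. lam (b * q) *s (1 * p))"
    by (rule cancel_first(3)[where \<gamma>="\<lambda>s t. tsum (\<Delta> x) (\<lambda>p q. lam (t * q) *s (s * p))"])
      (simp add: lam_simps)
  finally show ?thesis by simp
qed

text \<open>
  Write \<open>\<lambda> \<circ> S = \<lambda>(z -)\<close>.  Being a left integral, this form satisfies \<open>S(z) g = \<epsilon>(z) 1\<close> by
  \<open>lam_left_exchange\<close> at \<open>x = \<Lambda>\<close>, and \<open>\<epsilon>(z) = \<lambda>(S(\<Lambda>)) = 1\<close>.  Hence \<open>S(z) = g\<^sup>-\<^sup>1 = S(g)\<close>.
\<close>

lemma lam_S: "lam (S x) = lam (\<g> * x)"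
proof -
  have "Vector_Spaces.linear scale (*) (\<lambda>x. lam (S x))"
    by (simp add: Vector_Spaces.linear_iff vector_space_axioms vector_space_field lam_simps)
  from lam_representable[OF this] obtain z where z: "\<And>x. lam (z * x) = lam (S x)"
    by metis
  have e: "\<epsilon> z = 1"
    using z[of \<Lambda>] by (simp add: lam_Lam lam_S_Lam)
  have "tsum (\<Delta> z) (\<lambda>c d. \<epsilon> d *s (S c * \<g>)) = tsum (\<Delta> \<Lambda>) (\<lambda>p q. lam (z * q) *s p)"
    by (simp add: lam_left_exchange lam_Lam)
  also have "\<dots> = 1"
    by (simp add: z lam_S_integral lam_S_Lam)
  finally have "1 = tsum (\<Delta> z) (\<lambda>c d. S (\<epsilon> d *s c) * \<g>)"
    by (simp add: S_scale scale_mult_left)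
  also have "\<dots> = S z * \<g>"
    by (rule tsum_counit_right) (simp add: S_add distrib_right)
  finally have "S z * \<g> * S \<g> = S \<g>"
    by (metis mult_1)
  then have "z = \<g>"
    by - (rule S_inj, simp add: mult.assoc modular_S)
  then show ?thesis
    using z by simp
qed

end

section \<open>The Drinfeld element and the special grouplike element\<close>

context ribbon_hopf_algebra
begin

lemma tsum_R_cop:
  "balanced \<beta> \<Longrightarrow> tsum R (\<lambda>a b. tsum (\<Delta> x) (\<lambda>p q. \<beta> (a * p) (b * q))) =
    tsum (\<Delta> x) (\<lambda>p q. tsum R (\<lambda>a b. \<beta> (q * a) (p * b)))"
  using tsum_eqI[OF R_cop] by (simp add: tsum_mult2 tsum_flip2)

lemma tsum_R_id_cop:
  "balanced3 \<gamma> \<Longrightarrow> tsum R (\<lambda>a b. tsum (\<Delta> b) (\<lambda>p q. \<gamma> a p q)) =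
    tsum R (\<lambda>a b. tsum R (\<lambda>c d. \<gamma> (a * c) d b))"
  using tsum3_eqI[OF R_id_cop] by (simp add: tsum3_mult3 tsum3_legs tsum3_id_cop)

lemma tsum_R_cop_id:
  "balanced3 \<gamma> \<Longrightarrow> tsum R (\<lambda>a b. tsum (\<Delta> a) (\<lambda>p q. \<gamma> p q b)) =
    tsum R (\<lambda>a b. tsum R (\<lambda>c d. \<gamma> a c (b * d)))"
  using tsum3_eqI[OF R_cop_id] by (simp add: tsum3_mult3 tsum3_legs tsum3_cop_id)

text \<open>
  Applying \<open>\<epsilon>\<close> to the first factor of \<open>(\<Delta> \<otimes> id)(R) = R\<^sub>1\<^sub>3 R\<^sub>2\<^sub>3\<close> gives \<open>R = (1 \<otimes> r) R\<close> with
  \<open>r = (\<epsilon> \<otimes> id)(R)\<close>; multiply by the inverse of \<open>R\<close> on the right.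
\<close>

lemma counit_R_left: "tsum R (\<lambda>a b. \<epsilon> a *s b) = 1"
proof -
  obtain R' where R': "tensor2_eq scale (mult2 R R') [(1, 1)]"
    using R_invertible by blast
  have inv: "tsum R (\<lambda>a b. tsum R' (\<lambda>c d. \<beta> (a * c) (b * d))) = \<beta> 1 1"
    if "balanced \<beta>" for \<beta> :: "'h \<Rightarrow> 'h \<Rightarrow> 'h"
    using tsum_eqI[OF R' that] by (simp add: tsum_mult2)
  have "1 = tsum R (\<lambda>a b. tsum R' (\<lambda>c d. \<epsilon> (a * c) *s (b * d)))"
    by (subst inv) (simp_all add: multilinear_simps counit_mult counit_one)
  also have "\<dots> = tsum R (\<lambda>a b. tsum (\<Delta> a) (\<lambda>p q. tsum R' (\<lambda>c d. \<epsilon> (\<epsilon> p *s q * c) *s (b * d))))"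
    by (subst tsum_counit_left[where f="\<lambda>a. tsum R' (\<lambda>c d. \<epsilon> (a * c) *s (b * d))" for b])
      (simp_all add: multilinear_simps)
  also have "\<dots> = tsum R (\<lambda>a b. tsum R (\<lambda>p q. tsum R' (\<lambda>c d. \<epsilon> (\<epsilon> a *s p * c) *s (b * q * d))))"
    by (rule tsum_R_cop_id) (simp add: multilinear_simps)
  also have "\<dots> = tsum R (\<lambda>a b. \<epsilon> a *s b)"
    using inv[of "\<lambda>s t. \<epsilon> (\<epsilon> a *s s) *s (b * t)" for a b]
    by (simp add: multilinear_simps counit_one)
  finally show ?thesis ..
qed

lemma counit_R_right: "tsum R (\<lambda>a b. \<epsilon> b *s a) = 1"
proof -
  obtain R' where R': "tensor2_eq scale (mult2 R R') [(1, 1)]"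
    using R_invertible by blast
  have inv: "tsum R (\<lambda>a b. tsum R' (\<lambda>c d. \<beta> (a * c) (b * d))) = \<beta> 1 1"
    if "balanced \<beta>" for \<beta> :: "'h \<Rightarrow> 'h \<Rightarrow> 'h"
    using tsum_eqI[OF R' that] by (simp add: tsum_mult2)
  have "1 = tsum R (\<lambda>a b. tsum R' (\<lambda>c d. \<epsilon> (b * d) *s (a * c)))"
    by (subst inv) (simp_all add: multilinear_simps counit_mult counit_one)
  also have "\<dots> = tsum R (\<lambda>a b. tsum (\<Delta> b) (\<lambda>p q. tsum R' (\<lambda>c d. \<epsilon> (\<epsilon> q *s p * d) *s (a * c))))"
    by (subst tsum_counit_right[where f="\<lambda>b. tsum R' (\<lambda>c d. \<epsilon> (b * d) *s (a * c))" for a])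
      (simp_all add: multilinear_simps)
  also have "\<dots> = tsum R (\<lambda>a b. tsum R (\<lambda>p q. tsum R' (\<lambda>c d. \<epsilon> (\<epsilon> b *s q * d) *s (a * p * c))))"
    by (rule tsum_R_id_cop) (simp add: multilinear_simps)
  also have "\<dots> = tsum R (\<lambda>a b. \<epsilon> b *s a)"
    using inv[of "\<lambda>s t. \<epsilon> (\<epsilon> b *s t) *s (a * s)" for a b]
    by (simp add: multilinear_simps counit_one)
  finally show ?thesis ..
qed

text \<open>
  By \<open>(\<Delta> \<otimes> id)(R) = R\<^sub>1\<^sub>3 R\<^sub>2\<^sub>3\<close> the sum runs over \<open>a\<^sub>1 S(a\<^sub>2) \<otimes> b\<close>, which collapses to \<open>1 \<otimes> 1\<close>.  This makes
  \<open>(S \<otimes> id)(R)\<close> a right inverse of \<open>R\<close>.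
\<close>

lemma R_antipode_left:
  assumes \<beta>: "balanced \<beta>"
  shows "tsum R (\<lambda>a b. tsum R (\<lambda>c d. \<beta> (a * S c) (b * d))) = \<beta> 1 1"
proof -
  note D = balancedD[OF \<beta>]
  have "tsum R (\<lambda>a b. tsum R (\<lambda>c d. \<beta> (a * S c) (b * d))) =
      tsum R (\<lambda>a b. tsum (\<Delta> a) (\<lambda>p q. \<beta> (p * S q) b))"
    by (rule tsum_R_cop_id[symmetric]) (simp add: multilinear_simps D)
  also have "\<dots> = tsum R (\<lambda>a b. \<beta> 1 (\<epsilon> a *s b))"
    by (subst tsum_antipode_right[where f="\<lambda>s. \<beta> s b" for b]) (simp_all only: D(1) D(3)[symmetric])
  also have "\<dots> = \<beta> 1 (tsum R (\<lambda>a b. \<epsilon> a *s b))"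
    by (rule tsum_additive[symmetric]) (rule D)
  finally show ?thesis
    by (simp add: counit_R_left)
qed

text \<open>
  By \<open>(id \<otimes> \<Delta>)(R) = R\<^sub>1\<^sub>3 R\<^sub>1\<^sub>2\<close> the second factors combine to \<open>S(b\<^sub>1) b\<^sub>2\<close> and \<open>b\<^sub>1 S(b\<^sub>2)\<close>.
\<close>

lemma R_antipode_right:
  assumes \<beta>: "balanced \<beta>"
  shows "tsum R (\<lambda>a b. tsum R (\<lambda>c d. \<beta> (a * c) (S d * b))) = \<beta> 1 1"
    and "tsum R (\<lambda>a b. tsum R (\<lambda>c d. \<beta> (a * c) (d * S b))) = \<beta> 1 1"
proof -
  note D = balancedD[OF \<beta>]
  have e: "tsum R (\<lambda>a b. \<beta> (\<epsilon> b *s a) 1) = \<beta> 1 1"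
    using tsum_additive[of "\<lambda>s. \<beta> s 1" R "\<lambda>a b. \<epsilon> b *s a"] by (simp add: D counit_R_right)
  have "tsum R (\<lambda>a b. tsum R (\<lambda>c d. \<beta> (a * c) (S d * b))) =
      tsum R (\<lambda>a b. tsum (\<Delta> b) (\<lambda>p q. \<beta> a (S p * q)))"
    by (rule tsum_R_id_cop[symmetric]) (simp add: multilinear_simps D)
  also have "\<dots> = tsum R (\<lambda>a b. \<beta> (\<epsilon> b *s a) 1)"
    by (subst tsum_antipode_left[where f="\<lambda>s. \<beta> a s" for a]) (simp_all add: D)
  finally show "tsum R (\<lambda>a b. tsum R (\<lambda>c d. \<beta> (a * c) (S d * b))) = \<beta> 1 1"
    using e by simp
  have "tsum R (\<lambda>a b. tsum R (\<lambda>c d. \<beta> (a * c) (d * S b))) =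
      tsum R (\<lambda>a b. tsum (\<Delta> b) (\<lambda>p q. \<beta> a (p * S q)))"
    by (rule tsum_R_id_cop[symmetric]) (simp add: multilinear_simps D)
  also have "\<dots> = tsum R (\<lambda>a b. \<beta> (\<epsilon> b *s a) 1)"
    by (subst tsum_antipode_right[where f="\<lambda>s. \<beta> a s" for a]) (simp_all add: D)
  finally show "tsum R (\<lambda>a b. tsum R (\<lambda>c d. \<beta> (a * c) (d * S b))) = \<beta> 1 1"
    using e by simp
qed

text \<open>
  The triple product \<open>R \<cdot> (S \<otimes> id)(R) \<cdot> (S \<otimes> S)(R)\<close> equals \<open>(S \<otimes> S)(R)\<close> because its first two
  factors cancel, and \<open>R\<close> because its last two do.
\<close>

lemma R_antipode_invariant:
  assumes \<beta>: "balanced \<beta>"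
  shows "tsum R (\<lambda>a b. \<beta> (S a) (S b)) = tsum R \<beta>"
proof -
  note D = balancedD[OF \<beta>]
  let ?F = "\<lambda>a b c d e f. \<beta> (a * S c * S e) (b * d * S f)"
  have "tsum R (\<lambda>a b. tsum R (\<lambda>c d. tsum R (\<lambda>e f. ?F a b c d e f))) = tsum R (\<lambda>e f. \<beta> (S e) (S f))"
    using R_antipode_left[of "\<lambda>s t. tsum R (\<lambda>e f. \<beta> (s * S e) (t * S f))"]
    by (simp add: multilinear_simps D)
  moreover have "tsum R (\<lambda>a b. tsum R (\<lambda>c d. tsum R (\<lambda>e f. ?F a b c d e f))) = tsum R \<beta>"
  proof -
    have "tsum R (\<lambda>c d. tsum R (\<lambda>e f. ?F a b c d e f)) = \<beta> a b" for a b
      using R_antipode_right(2)[of "\<lambda>s t. \<beta> (a * S s) (b * t)"]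
      by (subst tsum_swap) (simp add: multilinear_simps D S_mult mult.assoc)
    then show ?thesis by simp
  qed
  ultimately show ?thesis by simp
qed

definition drinfeld :: 'h ("\<u>") where "\<u> = drinfeld_element S R"

lemma drinfeld_eq: "tsum R (\<lambda>a b. S b * a) = \<u>"
  by (simp add: drinfeld_def drinfeld_element_def tsum_def)

lemma S_drinfeld: "tsum R (\<lambda>a b. a * S b) = S \<u>"
proof -
  have "S \<u> = tsum R (\<lambda>a b. S a * S (S b))"
    by (simp add: tsum_additive[of S] S_add S_mult flip: drinfeld_eq)
  also have "\<dots> = tsum R (\<lambda>a b. a * S b)"
    by (rule R_antipode_invariant) (simp add: multilinear_simps)
  finally show ?thesis ..
qed

text \<open>
  Multiply \<open>R \<Delta>(x\<^sub>1) \<otimes> x\<^sub>2 = \<sigma>\<Delta>(x\<^sub>1) R \<otimes> x\<^sub>2\<close> together by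
  \<open>p \<otimes> q \<otimes> r \<mapsto> S\<^sup>2(r) S(q) p\<close>; the left side becomes \<open>u x\<close> and the right side \<open>S\<^sup>2(x) u\<close>.
\<close>

lemma S_S_drinfeld: "S (S x) * \<u> = \<u> * x"
proof -
  have "tsum (\<Delta> x) (\<lambda>y x3. tsum R (\<lambda>a b. tsum (\<Delta> y) (\<lambda>x1 x2. S (S x3) * S (b * x2) * (a * x1)))) =
      tsum (\<Delta> x) (\<lambda>y x3. tsum (\<Delta> y) (\<lambda>x1 x2. tsum R (\<lambda>a b. S (S x3) * S (x1 * b) * (x2 * a))))"
    by (subst tsum_R_cop[where \<beta>="\<lambda>s t. S (S x3) * S t * s" for x3]) (simp_all add: multilinear_simps)
  moreover have "tsum (\<Delta> x) (\<lambda>y x3. tsum R (\<lambda>a b. tsum (\<Delta> y) (\<lambda>x1 x2. S (S x3) * S (b * x2) * (a * x1)))) =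
      \<u> * x"
  proof -
    have "tsum (\<Delta> x) (\<lambda>y x3. tsum (\<Delta> y) (\<lambda>x1 x2. S (S x3) * S (b * x2) * (a * x1))) = S b * a * x" for a b
      using cancel_last(2)[of "\<lambda>s t. S (b * t) * (a * s)" x]
      by (simp add: multilinear_simps S_mult mult.assoc)
    then show ?thesis
      by (subst tsum_swap) (simp add: tsum_mult_right flip: drinfeld_eq)
  qed
  moreover have "tsum (\<Delta> x) (\<lambda>y x3. tsum (\<Delta> y) (\<lambda>x1 x2. tsum R (\<lambda>a b. S (S x3) * S (x1 * b) * (x2 * a)))) =
      S (S x) * \<u>"
    using cancel_first(1)[of "\<lambda>s t. tsum R (\<lambda>a b. S (S t) * S b * s * a)" x]
    by (simp add: multilinear_simps S_mult mult.assoc flip: drinfeld_eq)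
  ultimately show ?thesis by simp
qed

lemma R21_R_commutes:
  assumes \<beta>: "balanced \<beta>"
  shows "tsum (\<Delta> x) (\<lambda>p q. tsum R (\<lambda>a b. tsum R (\<lambda>c d. \<beta> (b * c * p) (a * d * q)))) =
    tsum (\<Delta> x) (\<lambda>p q. tsum R (\<lambda>a b. tsum R (\<lambda>c d. \<beta> (p * b * c) (q * a * d))))"
proof -
  note D = balancedD[OF \<beta>]
  have "tsum (\<Delta> x) (\<lambda>p q. tsum R (\<lambda>a b. tsum R (\<lambda>c d. \<beta> (b * c * p) (a * d * q)))) =
    tsum R (\<lambda>a b. tsum R (\<lambda>c d. tsum (\<Delta> x) (\<lambda>p q. \<beta> (b * (c * p)) (a * (d * q)))))"
    by (subst tsum_swap, subst (2) tsum_swap) (simp add: mult.assoc)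
  also have "\<dots> = tsum R (\<lambda>a b. tsum (\<Delta> x) (\<lambda>p q. tsum R (\<lambda>c d. \<beta> (b * (q * c)) (a * (p * d)))))"
    by (subst tsum_R_cop[where \<beta>="\<lambda>s t. \<beta> (b * s) (a * t)" for a b]) (simp_all add: multilinear_simps D)
  also have "\<dots> = tsum R (\<lambda>a b. tsum (\<Delta> x) (\<lambda>p q. tsum R (\<lambda>c d. \<beta> (b * q * c) (a * p * d))))"
    by (simp add: mult.assoc)
  also have "\<dots> = tsum (\<Delta> x) (\<lambda>p q. tsum R (\<lambda>a b. tsum R (\<lambda>c d. \<beta> (p * b * c) (q * a * d))))"
    by (rule tsum_R_cop[where \<beta>="\<lambda>s t. tsum R (\<lambda>c d. \<beta> (t * c) (s * d))"]) (simp add: multilinear_simps D)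
  finally show ?thesis .
qed

text \<open>
  Since \<open>R\<^sub>2\<^sub>1 R\<close> commutes with \<open>\<Delta>(S(b))\<close> and \<open>R\<close> intertwines \<open>\<Delta>(a)\<close> with its flip,
  \<open>R\<^sub>2\<^sub>1 R \<Delta>(S(b) a) = (S(b\<^sub>2) \<otimes> S(b\<^sub>1)) R\<^sub>2\<^sub>1 (a\<^sub>2 \<otimes> a\<^sub>1) R\<close>.  Expanding \<open>(\<Delta> \<otimes> \<Delta>)(R)\<close> into four copies of \<open>R\<close>
  gives six copies in all: one cancels against \<open>R\<^sub>2\<^sub>1\<close>, two become \<open>u\<close>, and the last cancels against
  the right-hand \<open>R\<close> once \<open>u\<close> has been moved to the right with \<open>S_S_drinfeld\<close>.
\<close>

lemma drinfeld_cop: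
  assumes \<beta>: "balanced \<beta>"
  shows "tsum (\<Delta> \<u>) (\<lambda>p q. tsum R (\<lambda>a b. tsum R (\<lambda>c d. \<beta> (b * c * p) (a * d * q)))) = \<beta> \<u> \<u>"
proof -
  note D = balancedD[OF \<beta>]
  define G where "G s t p q = tsum R (\<lambda>k l. tsum R (\<lambda>m n. \<beta> (S q * l * t * m) (S p * k * s * n)))"
    for s t p q
  have G: "balanced (\<lambda>s t. G s t p q)" "balanced (G s t)" for s t p q
    unfolding G_def by (simp_all add: multilinear_simps D)
  note G_linear = G(1)[THEN balancedD(1)] G(1)[THEN balancedD(2)]
    G(2)[THEN balancedD(1)] G(2)[THEN balancedD(2)] G(2)[THEN balancedD(3)]
  have G_scale: "G (r *s s) t p q = G s t p (r *s q)" "G s (r *s t) p q = G s t p (r *s q)" for r s t p q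
    unfolding G_def by (simp_all add: multilinear_simps D)
  have 1: "tsum (\<Delta> (S b * a)) (\<lambda>p q. tsum R (\<lambda>k l. tsum R (\<lambda>m n. \<beta> (l * m * p) (k * n * q)))) =
      tsum (\<Delta> b) (\<lambda>p q. tsum (\<Delta> a) (\<lambda>s t. G s t p q))" for a b
  proof -
    have "tsum (\<Delta> (S b * a)) (\<lambda>p q. tsum R (\<lambda>k l. tsum R (\<lambda>m n. \<beta> (l * m * p) (k * n * q)))) =
        tsum (\<Delta> (S b)) (\<lambda>p q. tsum (\<Delta> a) (\<lambda>s t.
          tsum R (\<lambda>k l. tsum R (\<lambda>m n. \<beta> (l * m * (p * s)) (k * n * (q * t))))))"
      by (rule tsum_cop_mult) (simp add: multilinear_simps D)
    also have "\<dots> = tsum (\<Delta> a) (\<lambda>s t. tsum (\<Delta> (S b)) (\<lambda>p q.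
          tsum R (\<lambda>k l. tsum R (\<lambda>m n. \<beta> (l * m * p * s) (k * n * q * t)))))"
      by (subst tsum_swap) (simp add: mult.assoc)
    also have "\<dots> = tsum (\<Delta> a) (\<lambda>s t. tsum (\<Delta> (S b)) (\<lambda>p q.
          tsum R (\<lambda>k l. tsum R (\<lambda>m n. \<beta> (p * l * m * s) (q * k * n * t)))))"
      by (subst R21_R_commutes[where \<beta>="\<lambda>x y. \<beta> (x * s) (y * t)" for s t])
        (simp_all add: multilinear_simps D)
    also have "\<dots> = tsum (\<Delta> (S b)) (\<lambda>p q. tsum R (\<lambda>k l. tsum R (\<lambda>m n. tsum (\<Delta> a) (\<lambda>s t.
          \<beta> (p * l * (m * s)) (q * k * (n * t))))))"
      by (subst tsum_swap, subst (2) tsum_swap, subst (3) tsum_swap) (simp add: mult.assoc)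
    also have "\<dots> = tsum (\<Delta> (S b)) (\<lambda>p q. tsum R (\<lambda>k l. tsum (\<Delta> a) (\<lambda>s t. tsum R (\<lambda>m n.
          \<beta> (p * l * (t * m)) (q * k * (s * n))))))"
      by (subst tsum_R_cop[where \<beta>="\<lambda>x y. \<beta> (p * l * x) (q * k * y)" for p q k l])
        (simp_all add: multilinear_simps D)
    also have "\<dots> = tsum (\<Delta> (S b)) (\<lambda>p q. tsum (\<Delta> a) (\<lambda>s t. tsum R (\<lambda>k l. tsum R (\<lambda>m n.
          \<beta> (p * l * t * m) (q * k * s * n)))))"
      by (subst (2) tsum_swap) (simp add: mult.assoc)
    also have "\<dots> = tsum (\<Delta> b) (\<lambda>p q. tsum (\<Delta> a) (\<lambda>s t. G s t p q))"
      unfolding G_def by (rule tsum_cop_S) (simp add: multilinear_simps D)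
    finally show ?thesis .
  qed
  have "tsum (\<Delta> \<u>) (\<lambda>p q. tsum R (\<lambda>a b. tsum R (\<lambda>c d. \<beta> (b * c * p) (a * d * q)))) =
      tsum R (\<lambda>a b. tsum (\<Delta> (S b * a)) (\<lambda>p q. tsum R (\<lambda>k l. tsum R (\<lambda>m n. \<beta> (l * m * p) (k * n * q)))))"
    unfolding drinfeld_eq[symmetric]
    by (rule tsum_additive, rule tsum_cop_add) (simp add: multilinear_simps D)
  also have "\<dots> = tsum R (\<lambda>a b. tsum (\<Delta> b) (\<lambda>p q. tsum (\<Delta> a) (\<lambda>s t. G s t p q)))"
    by (simp only: 1)
  also have "\<dots> = tsum R (\<lambda>a b. tsum R (\<lambda>c d. tsum (\<Delta> (a * c)) (\<lambda>s t. G s t d b)))"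
    by (rule tsum_R_id_cop) (simp add: multilinear_simps G_linear G_scale)
  also have "\<dots> = tsum R (\<lambda>a b. tsum (\<Delta> a) (\<lambda>a1 a2. tsum R (\<lambda>c d. tsum (\<Delta> c) (\<lambda>c1 c2.
      G (a1 * c1) (a2 * c2) d b))))"
    by (subst tsum_cop_mult[OF G(1)], subst (2) tsum_swap) simp
  also have "\<dots> = tsum R (\<lambda>a b. tsum (\<Delta> a) (\<lambda>a1 a2. tsum R (\<lambda>c d. tsum R (\<lambda>e f.
      G (a1 * c) (a2 * e) (d * f) b))))"
    by (subst tsum_R_cop_id[where \<gamma>="\<lambda>c1 c2 d. G (a1 * c1) (a2 * c2) d b" for a1 a2 b])
      (simp_all add: multilinear_simps G_linear G_scale)
  also have "\<dots> = tsum R (\<lambda>a b. tsum R (\<lambda>a' b'. tsum R (\<lambda>c d. tsum R (\<lambda>e f.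
      G (a * c) (a' * e) (d * f) (b * b')))))"
    by (rule tsum_R_cop_id[where \<gamma>="\<lambda>a1 a2 b. tsum R (\<lambda>c d. tsum R (\<lambda>e f.
      G (a1 * c) (a2 * e) (d * f) b))"]) (simp_all add: multilinear_simps G_linear G_scale)
  also have "\<dots> = tsum R (\<lambda>e f. tsum R (\<lambda>m n. tsum R (\<lambda>a' b'. tsum R (\<lambda>c d.
      tsum R (\<lambda>a b. tsum R (\<lambda>k l. \<beta> (S b' * (S b * l) * a' * e * m) (S f * S d * (k * a) * c * n)))))))"
  proof -
    have reorder: "tsum xs (\<lambda>a b. tsum ys (\<lambda>a' b'. tsum zs (\<lambda>c d. tsum vs (\<lambda>e f.
        tsum ws (\<lambda>k l. tsum us (\<lambda>m n. F a b a' b' c d e f k l m n)))))) =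
      tsum vs (\<lambda>e f. tsum us (\<lambda>m n. tsum ys (\<lambda>a' b'. tsum zs (\<lambda>c d.
        tsum xs (\<lambda>a b. tsum ws (\<lambda>k l. F a b a' b' c d e f k l m n))))))"
      for xs ys zs vs ws us :: "('h \<times> 'h) list" and F :: "_ \<Rightarrow> _ \<Rightarrow> _ \<Rightarrow> _ \<Rightarrow> _ \<Rightarrow> _ \<Rightarrow> _ \<Rightarrow> _ \<Rightarrow> _ \<Rightarrow> _ \<Rightarrow> _ \<Rightarrow> _ \<Rightarrow> 'a"
      by (simp only: tsum_swap[of xs ys] tsum_swap[of xs zs] tsum_swap[of xs vs] tsum_swap[of xs us]
          tsum_swap[of ws us] tsum_swap[of ys vs] tsum_swap[of zs vs] tsum_swap[of ys us] tsum_swap[of zs us])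
    show ?thesis
      unfolding G_def by (subst reorder) (simp add: S_mult mult.assoc)
  qed
  also have "\<dots> = tsum R (\<lambda>e f. tsum R (\<lambda>m n. tsum R (\<lambda>a' b'. tsum R (\<lambda>c d.
      \<beta> (S b' * a' * e * m) (S f * (S d * c) * n)))))"
  proof -
    have "tsum R (\<lambda>a b. tsum R (\<lambda>k l. \<beta> (S b' * (S b * l) * a' * e * m) (S f * S d * (k * a) * c * n))) =
       \<beta> (S b' * a' * e * m) (S f * (S d * c) * n)" for a' b' c d e f m n
      using R_antipode_right(1)[of "\<lambda>s t. \<beta> (S b' * t * a' * e * m) (S f * S d * s * c * n)"]
      by (subst tsum_swap) (simp add: multilinear_simps D mult.assoc)
    then show ?thesis by simp
  qed
  also have "\<dots> = tsum R (\<lambda>e f. tsum R (\<lambda>m n. \<beta> (\<u> * e * m) (S f * \<u> * n)))"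
  proof -
    have "tsum R (\<lambda>c d. \<beta> x (S f * (S d * c) * n)) = \<beta> x (S f * \<u> * n)" for x f n
      unfolding drinfeld_eq[symmetric]
      by (rule tsum_additive[symmetric]) (simp add: multilinear_simps D)
    moreover have "tsum R (\<lambda>a' b'. \<beta> (S b' * a' * e * m) x) = \<beta> (\<u> * e * m) x" for x e m
      unfolding drinfeld_eq[symmetric]
      by (rule tsum_additive[where f="\<lambda>s. \<beta> (s * e * m) x", symmetric]) (simp add: multilinear_simps D)
    ultimately show ?thesis by simp
  qed
  also have "\<dots> = tsum R (\<lambda>e f. tsum R (\<lambda>m n. \<beta> (\<u> * (e * m)) (S (S n * f) * \<u>)))"
    by (simp add: mult.assoc S_mult S_S_drinfeld)
  also have "\<dots> = \<beta> \<u> \<u>"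
    using R_antipode_right(1)[of "\<lambda>s t. \<beta> (\<u> * s) (S t * \<u>)"] by (simp add: multilinear_simps D)
  finally show ?thesis .
qed

definition special :: 'h ("\<G>") where "\<G> = special_grouplike S R \<theta>"

lemma special_eq: "\<G> = \<theta> * \<u>"
  by (simp add: special_def special_grouplike_def drinfeld_def)

lemma special_cop:
  assumes \<beta>: "balanced \<beta>"
  shows "tsum (\<Delta> \<G>) \<beta> = \<beta> \<G> \<G>"
proof -
  note D = balancedD[OF \<beta>]
  have "tsum (\<Delta> \<G>) \<beta> = tsum (\<Delta> \<theta>) (\<lambda>s t. tsum (\<Delta> \<u>) (\<lambda>p q. \<beta> (s * p) (t * q)))"
    unfolding special_eq by (rule tsum_cop_mult[OF \<beta>])
  also have "\<dots> = tsum R (\<lambda>a b. tsum R (\<lambda>c d. tsum (\<Delta> \<u>) (\<lambda>p q. \<beta> (\<theta> * b * c * p) (\<theta> * a * d * q))))"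
    by (subst tsum_eqI[OF twist_cop]) (simp_all add: multilinear_simps D tsum_mult2 tsum_flip2)
  also have "\<dots> = tsum (\<Delta> \<u>) (\<lambda>p q. tsum R (\<lambda>a b. tsum R (\<lambda>c d. \<beta> (\<theta> * (b * c * p)) (\<theta> * (a * d * q)))))"
    by (subst (2) tsum_swap, subst tsum_swap) (simp add: mult.assoc)
  also have "\<dots> = \<beta> \<G> \<G>"
    unfolding special_eq
    by (rule drinfeld_cop[where \<beta>="\<lambda>s t. \<beta> (\<theta> * s) (\<theta> * t)"]) (simp add: multilinear_simps D)
  finally show ?thesis .
qed

text \<open>
  As \<open>G\<close> is grouplike, \<open>G = \<epsilon>(G) G\<close>; so \<open>\<epsilon>(G)\<close> is an idempotent of the field, and it equals
  \<open>\<epsilon>(\<theta>)\<close>, which is nonzero because \<open>\<theta>\<close> is invertible.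
\<close>

lemma counit_special: "\<epsilon> \<G> = 1"
proof -
  have "\<epsilon> \<G> = \<epsilon> \<theta> * \<epsilon> \<u>"
    by (simp add: special_eq counit_mult)
  also have "\<epsilon> \<u> = \<epsilon> (tsum R (\<lambda>a b. \<epsilon> a *s b))"
    unfolding drinfeld_eq[symmetric]
    by (subst (1 2) tsum_additive[of \<epsilon>]) (simp_all add: counit_add counit_scale counit_mult counit_S mult.commute)
  also have "\<dots> = 1"
    by (simp add: counit_R_left counit_one)
  finally have eq: "\<epsilon> \<G> = \<epsilon> \<theta>" by simp
  obtain \<theta>' where "\<theta> * \<theta>' = 1"
    using twist_invertible by blast
  then have "\<epsilon> \<theta> * \<epsilon> \<theta>' = 1"
    by (metis counit_mult counit_one)
  then have nz: "\<epsilon> \<G> \<noteq> 0"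
    using eq by auto
  have "\<G> = tsum (\<Delta> \<G>) (\<lambda>a b. \<epsilon> a *s b)"
    by (rule tsum_counit_left[symmetric]) simp
  also have "\<dots> = \<epsilon> \<G> *s \<G>"
    by (rule special_cop) (simp add: multilinear_simps)
  finally have "\<epsilon> \<G> = \<epsilon> \<G> * \<epsilon> \<G>"
    by (metis counit_scale)
  then show ?thesis
    using nz by simp
qed

lemma special_S: "S \<G> * \<G> = 1" "\<G> * S \<G> = 1"
proof -
  show "S \<G> * \<G> = 1"
    using tsum_antipode_left[of "\<lambda>x. x" \<G>] special_cop[of "\<lambda>a b. S a * b"]
    by (simp add: multilinear_simps counit_special)
  show "\<G> * S \<G> = 1"
    using tsum_antipode_right[of "\<lambda>x. x" \<G>] special_cop[of "\<lambda>a b. a * S b"]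
    by (simp add: multilinear_simps counit_special)
qed

lemma S_S_special: "S (S x) * \<G> = \<G> * x"
proof -
  have "S (S x) * \<G> = \<theta> * (S (S x) * \<u>)"
    unfolding special_eq by (metis mult.assoc twist_central)
  then show ?thesis
    by (simp add: S_S_drinfeld special_eq mult.assoc)
qed

end

section \<open>Traces\<close>

locale ribbon_integral = ribbon_hopf_algebra scale \<Delta> \<epsilon> S R \<theta> + hopf_integral scale \<Delta> \<epsilon> S Basis lam
  for scale :: "'k::field \<Rightarrow> 'h::ring_1 \<Rightarrow> 'h" (infixr \<open>*s\<close> 75)
    and \<Delta> \<epsilon> S R \<theta> Basis lam
begin

text \<open>
  The action \<open>x \<leftharpoonup> \<nu>\<close>, an algebra endomorphism because \<open>\<nu>\<close> is multiplicative.
\<close>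

definition act :: "'h \<Rightarrow> 'h" where
  "act x = tsum (\<Delta> x) (\<lambda>a b. \<nu> a *s b)"

lemma act_right_eq: "act_right scale \<Delta> x (distinguished_grouplike scale \<epsilon>) = act x"
  by (simp add: act_right_def act_def tsum_def distinguished_grouplike_eq)

lemma act_balanced: "balanced (\<lambda>a b. \<nu> a *s b)"
  by (simp add: multilinear_simps nu_add nu_scale)

lemma act_scale: "act (r *s x) = r *s act x"
  unfolding act_def by (simp add: tsum_cop_scale[OF act_balanced] multilinear_simps nu_scale)

lemma act_mult: "act (x * y) = act x * act y"
  unfolding act_def
  by (simp add: tsum_cop_mult[OF act_balanced] nu_mult tsum_mult_left tsum_mult_right tsum_scale
      scale_mult_left scale_mult_right tsum_swap[of "\<Delta> x"] mult.commute)

lemma act_one: "act 1 = 1"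
  unfolding act_def by (simp add: tsum_cop_one[OF act_balanced] nu_one)

lemma act_special: "act \<G> = \<nu> \<G> *s \<G>"
  unfolding act_def by (rule special_cop[OF act_balanced])

lemma nu_special_nonzero: "\<nu> \<G> \<noteq> 0"
proof
  assume "\<nu> \<G> = 0"
  then have "\<nu> (S \<G> * \<G>) = 0" by (simp add: nu_mult)
  then show False by (simp add: special_S nu_one)
qed

text \<open>
  \<open>S\<^sup>2\<close> is conjugation by \<open>G\<close>, and \<open>\<nu>\<close> is an algebra map to a field.
\<close>

lemma nu_S_S: "\<nu> (S (S x)) = \<nu> x"
proof -
  have "\<nu> (S (S x)) * \<nu> \<G> = \<nu> \<G> * \<nu> x"
    by (simp only: S_S_special flip: nu_mult)
  then show ?thesis
    using nu_special_nonzero by simp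
qed

lemma act_S_S: "S (S (act x)) = act (S (S x))"
proof -
  have "act (S (S x)) = tsum (\<Delta> (S x)) (\<lambda>a b. \<nu> (S b) *s S a)"
    unfolding act_def by (rule tsum_cop_S[OF act_balanced])
  also have "\<dots> = tsum (\<Delta> x) (\<lambda>a b. \<nu> (S (S a)) *s S (S b))"
    by (rule tsum_cop_S) (simp add: multilinear_simps nu_add nu_scale)
  finally show ?thesis
    by (simp add: act_def nu_S_S S_tsum S_scale)
qed

lemma lam_swap: "lam (a * x) = lam (act (S (S x)) * a)"
  by (simp add: nakayama[of a x] act_S_S flip: act_def)

definition hnu :: 'h ("\<h>") where "\<h> = h_nu scale \<epsilon> R"

lemma hnu_eq: "\<h> = tsum R (\<lambda>a b. \<nu> b *s a)"
  by (simp add: hnu_def h_nu_def tsum_def distinguished_grouplike_eq)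

text \<open>
  Apply \<open>\<lambda>\<close> to the second factor of \<open>R \<Delta>(\<Lambda>) = \<sigma>\<Delta>(\<Lambda>) R\<close>.  The left side
  \<open>\<Sum> a\<^sub>i \<Lambda>\<^sub>1 \<lambda>(b\<^sub>i \<Lambda>\<^sub>2)\<close> is \<open>S(u) g\<close> by \<open>lam_left_exchange\<close>; the right side
  \<open>\<Sum> \<Lambda>\<^sub>2 a\<^sub>i \<lambda>(\<Lambda>\<^sub>1 b\<^sub>i)\<close> is \<open>\<Sum> S(b\<^sub>i \<leftharpoonup> \<nu>) a\<^sub>i\<close> by \<open>lam_exchange\<close>, and \<open>(id \<otimes> \<Delta>)(R) = R\<^sub>1\<^sub>3 R\<^sub>1\<^sub>2\<close> splits it
  into \<open>u h\<^sub>\<nu>\<close>.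
\<close>

lemma drinfeld_hnu: "\<u> * \<h> = S \<u> * \<g>"
proof -
  have "tsum R (\<lambda>a b. tsum (\<Delta> \<Lambda>) (\<lambda>p q. lam (b * q) *s (a * p))) =
      tsum (\<Delta> \<Lambda>) (\<lambda>p q. tsum R (\<lambda>a b. lam (p * b) *s (q * a)))"
    by (rule tsum_R_cop) (simp add: lam_simps)
  moreover have "tsum R (\<lambda>a b. tsum (\<Delta> \<Lambda>) (\<lambda>p q. lam (b * q) *s (a * p))) = S \<u> * \<g>"
  proof -
    have "tsum (\<Delta> \<Lambda>) (\<lambda>p q. lam (b * q) *s (a * p)) = a * S b * \<g>" for a b
    proof -
      have "tsum (\<Delta> \<Lambda>) (\<lambda>p q. lam (b * q) *s (a * p)) = a * tsum (\<Delta> \<Lambda>) (\<lambda>p q. lam (b * q) *s p)"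
        by (simp add: tsum_mult_left scale_mult_right)
      also have "tsum (\<Delta> \<Lambda>) (\<lambda>p q. lam (b * q) *s p) = tsum (\<Delta> b) (\<lambda>c d. S (\<epsilon> d *s c) * \<g>)"
        by (simp add: lam_left_exchange lam_Lam S_scale scale_mult_left)
      also have "tsum (\<Delta> b) (\<lambda>c d. S (\<epsilon> d *s c) * \<g>) = S b * \<g>"
        by (rule tsum_counit_right) (simp add: multilinear_simps)
      finally show ?thesis by (simp add: mult.assoc)
    qed
    then show ?thesis
      by (simp add: tsum_mult_right flip: S_drinfeld)
  qed
  moreover have "tsum (\<Delta> \<Lambda>) (\<lambda>p q. tsum R (\<lambda>a b. lam (p * b) *s (q * a))) = \<u> * \<h>"
  proof -
    have "tsum (\<Delta> \<Lambda>) (\<lambda>p q. lam (p * b) *s (q * a)) = tsum (\<Delta> b) (\<lambda>c d. \<nu> c *s (S d * a))" for a b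
    proof -
      have "tsum (\<Delta> \<Lambda>) (\<lambda>p q. lam (p * b) *s (q * a)) = tsum (\<Delta> \<Lambda>) (\<lambda>p q. lam (p * b) *s q) * a"
        by (simp add: tsum_mult_right scale_mult_left)
      then show ?thesis
        by (simp add: lam_exchange nu_def tsum_mult_right scale_mult_left)
    qed
    then have "tsum (\<Delta> \<Lambda>) (\<lambda>p q. tsum R (\<lambda>a b. lam (p * b) *s (q * a))) =
        tsum R (\<lambda>a b. tsum (\<Delta> b) (\<lambda>c d. \<nu> c *s (S d * a)))"
      by (subst tsum_swap) simp
    also have "\<dots> = tsum R (\<lambda>a b. tsum R (\<lambda>c d. \<nu> d *s (S b * (a * c))))"
      by (rule tsum_R_id_cop) (simp add: multilinear_simps nu_add nu_scale)
    also have "\<dots> = \<u> * \<h>"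
      unfolding hnu_eq drinfeld_eq[symmetric] tsum_mult_right
      by (simp add: tsum_mult_left scale_mult_right mult.assoc)
    finally show ?thesis .
  qed
  ultimately show ?thesis by simp
qed

lemma modular_eq: "\<g> = \<G> * \<G> * \<h>"
proof -
  have "\<G> * \<G> * \<h> = \<G> * \<theta> * (\<u> * \<h>)"
    by (simp add: special_eq mult.assoc)
  also have "\<dots> = \<G> * (\<theta> * S \<u>) * \<g>"
    by (simp add: drinfeld_hnu mult.assoc)
  also have "\<theta> * S \<u> = S \<G>"
    by (simp add: special_eq S_mult twist_antipode twist_central)
  finally show ?thesis
    by (simp add: special_S)
qed

lemma mem_L_space: "z \<in> L_space scale \<Delta> \<epsilon> \<longleftrightarrow> (\<forall>x. act x * z = z * x)"
  by (simp add: L_space_def act_right_eq)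

lemma T_map_eq: "T_map scale \<Delta> \<epsilon> S R z = act (S z) * \<h>"
  by (simp add: T_map_def act_right_eq hnu_def)

text \<open>
  Move \<open>x\<close> to the front with the Nakayama formula and through \<open>G\<close> as \<open>G x = S\<^sup>2(x) G\<close>.  Nondegeneracy
  leaves the defining condition of \<open>L(H)\<close> for \<open>S\<^sup>2(x)\<close>, which is an arbitrary element.
\<close>

lemma symmetric_iff:
  "(\<forall>x y. lam (z * \<G> * (x * y)) = lam (z * \<G> * (y * x))) \<longleftrightarrow> (\<forall>x. act x * z = z * x)"
proof -
  have "(\<forall>y. lam (z * \<G> * (x * y)) = lam (z * \<G> * (y * x))) \<longleftrightarrow>
      act (S (S x)) * z = z * S (S x)" for x
  proof -
    have "lam (z * \<G> * (y * x)) = lam (act (S (S x)) * z * \<G> * y)" for y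
      using lam_swap[of "z * \<G> * y" x] by (simp add: mult.assoc)
    moreover have "z * \<G> * (x * y) = z * S (S x) * \<G> * y" for y
      by (simp add: S_S_special mult.assoc flip: mult.assoc[of "S (S x)"])
    ultimately have "(\<forall>y. lam (z * \<G> * (x * y)) = lam (z * \<G> * (y * x))) \<longleftrightarrow>
        (\<forall>y. lam (z * S (S x) * \<G> * y) = lam (act (S (S x)) * z * \<G> * y))"
      by simp
    also have "\<dots> \<longleftrightarrow> z * S (S x) * \<G> = act (S (S x)) * z * \<G>"
      using lam_eqI_left by metis
    also have "\<dots> \<longleftrightarrow> z * S (S x) = act (S (S x)) * z"
      by (metis mult.assoc mult.right_neutral special_S(2))
    finally show ?thesis by auto
  qed
  then show ?thesis
    using S_surj by metis
qed

text \<open>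
  With \<open>S(y) = zG\<close>, the form \<open>t = \<lambda>(zG -)\<close> satisfies
  \<open>t(S(x)) = \<lambda>(S(x y)) = \<lambda>(g x y) = \<lambda>((S(zG) \<leftharpoonup> \<nu>) g x)\<close>.  The hypothesis on \<open>z\<close>
  at \<open>x = G\<close>, and its image under \<open>S\<close> and \<open>- \<leftharpoonup> \<nu>\<close>, are the commutation rules \<open>zG\<close> and \<open>wG\<close> that turn
  \<open>(S(zG) \<leftharpoonup> \<nu>) G\<^sup>2 h\<^sub>\<nu>\<close> into \<open>\<nu>(G) G (S(z) \<leftharpoonup> \<nu>) h\<^sub>\<nu>\<close>.
\<close>

lemma invariant_iff:
  assumes z: "\<And>x. act x * z = z * x"
  shows "(\<forall>x. lam (z * \<G> * S x) = lam (z * \<G> * x)) \<longleftrightarrow> act (S z) * \<h> = z"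
proof -
  let ?c = "\<nu> \<G>" and ?w = "act (S z)"
  have zG: "z * \<G> = ?c *s (\<G> * z)"
    using z[of \<G>] by (simp add: act_special scale_mult_left)
  have "S (z * \<G>) = S (?c *s (\<G> * z))"
    by (simp only: zG)
  then have "\<G> * S (z * \<G>) * \<G> = \<G> * S (?c *s (\<G> * z)) * \<G>"
    by simp
  then have "S z * \<G> = ?c *s (\<G> * S z)"
    by (simp add: S_mult S_scale scale_mult_left scale_mult_right special_S mult.assoc
        flip: mult.assoc[of \<G> "S \<G>"])
  then have "?w * act \<G> = ?c *s (act \<G> * ?w)"
    by (metis act_mult act_scale)
  then have "?c *s (?w * \<G>) = ?c *s (?c *s (\<G> * ?w))"
    by (simp add: act_special scale_mult_left scale_mult_right)
  then have wG: "?w * \<G> = ?c *s (\<G> * ?w)"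
    by (rule scale_left_imp_eq[OF nu_special_nonzero])
  have aSG: "?c *s act (S \<G>) = S \<G>"
  proof -
    have "act (S \<G>) * act \<G> = 1"
      by (simp add: special_S act_one flip: act_mult)
    then have "?c *s act (S \<G>) * \<G> = 1"
      by (simp add: act_special scale_mult_left scale_mult_right)
    then have "?c *s act (S \<G>) * (\<G> * S \<G>) = S \<G>"
      by (metis mult.assoc mult_1)
    then show ?thesis by (simp add: special_S)
  qed
  obtain y where y: "S y = z * \<G>"
    using S_surj by blast
  have "act (S (S y)) * \<g> = act (S \<G>) * ?w * \<G> * \<G> * \<h>"
    by (simp add: y S_mult act_mult modular_eq mult.assoc)
  also have "\<dots> = act (S \<G>) * (?w * \<G>) * \<G> * \<h>"
    by (simp add: mult.assoc)
  also have "\<dots> = ?c *s (act (S \<G>) * \<G> * (?w * \<G>) * \<h>)"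
    by (subst wG) (simp add: scale_mult_left scale_mult_right mult.assoc)
  also have "\<dots> = (?c *s act (S \<G>)) * \<G> * (?c *s (\<G> * ?w)) * \<h>"
    by (simp only: wG scale_mult_left)
  also have "\<dots> = ?c *s (\<G> * (?w * \<h>))"
    by (simp add: aSG special_S scale_mult_left scale_mult_right mult.assoc)
  finally have key: "act (S (S y)) * \<g> = ?c *s (\<G> * (?w * \<h>))" .
  have "lam (z * \<G> * S x) = lam (act (S (S y)) * \<g> * x)" for x
  proof -
    have "lam (z * \<G> * S x) = lam (S (x * y))"
      by (simp add: S_mult y)
    also have "\<dots> = lam (\<g> * x * y)"
      by (simp add: lam_S mult.assoc)
    also have "\<dots> = lam (act (S (S y)) * (\<g> * x))"
      by (rule lam_swap)
    finally show ?thesis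
      by (simp add: mult.assoc)
  qed
  then have "(\<forall>x. lam (z * \<G> * S x) = lam (z * \<G> * x)) \<longleftrightarrow> act (S (S y)) * \<g> = z * \<G>"
    using lam_eqI_left by metis
  also have "\<dots> \<longleftrightarrow> \<G> * (?w * \<h>) = \<G> * z"
    using nu_special_nonzero by (simp add: key zG)
  also have "\<dots> \<longleftrightarrow> ?w * \<h> = z"
    by (metis mult.assoc mult_1 special_S(1))
  finally show ?thesis .
qed

lemma traces_eq:
  "dual_mult lam (z * \<G>) \<in> traces scale S \<longleftrightarrow>
    z \<in> L_space scale \<Delta> \<epsilon> \<and> T_map scale \<Delta> \<epsilon> S R z = z"
proof -
  have "dual_mult lam (z * \<G>) \<in> traces scale S \<longleftrightarrow>
      (\<forall>x y. lam (z * \<G> * (x * y)) = lam (z * \<G> * (y * x))) \<and>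
      (\<forall>x. lam (z * \<G> * S x) = lam (z * \<G> * x))"
    by (simp add: traces_def dual_mult_def lam_pairing_linear)
  also have "\<dots> \<longleftrightarrow> z \<in> L_space scale \<Delta> \<epsilon> \<and> T_map scale \<Delta> \<epsilon> S R z = z"
    unfolding symmetric_iff mem_L_space T_map_eq using invariant_iff by blast
  finally show ?thesis .
qed

lemma dual_mult_surj:
  assumes "Vector_Spaces.linear scale (*) t"
  shows "\<exists>z. dual_mult lam (z * \<G>) = t"
proof -
  obtain z where z: "\<And>x. lam (z * x) = t x"
    using lam_representable[OF assms] by blast
  have "dual_mult lam (z * S \<G> * \<G>) = t"
    by (simp add: dual_mult_def mult.assoc[of z] special_S z)
  then show ?thesis by blast
qed

lemma traces_iso:
  "linear_iso_betw scale (\<lambda>r f x. r * f x) (\<lambda>z. dual_mult lam (z * special_grouplike S R \<theta>))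
    {z \<in> L_space scale \<Delta> \<epsilon>. T_map scale \<Delta> \<epsilon> S R z = z} (traces scale S)"
proof -
  let ?f = "\<lambda>z. dual_mult lam (z * \<G>)"
  let ?U = "{z \<in> L_space scale \<Delta> \<epsilon>. T_map scale \<Delta> \<epsilon> S R z = z}"
  have U: "?U = {z. ?f z \<in> traces scale S}"
    by (simp add: traces_eq)
  interpret dual: module "\<lambda>(r::'k) (f::'h \<Rightarrow> 'k) x. r * f x"
    by unfold_locales (simp_all add: fun_eq_iff algebra_simps)
  have add: "?f (x + y) = ?f x + ?f y" for x y
    by (simp add: fun_eq_iff dual_mult_def distrib_right lam_add)
  have scale: "?f (r *s x) = (\<lambda>y. r * ?f x y)" for r x
    by (simp add: fun_eq_iff dual_mult_def scale_mult_left lam_scale)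
  have zero: "dual_mult lam 0 = 0"
    by (simp add: fun_eq_iff dual_mult_def lam_zero)
  have traces: "dual.subspace (traces scale S)"
    by (simp add: dual.subspace_def traces_def Vector_Spaces.linear_iff vector_space_axioms
        vector_space_field algebra_simps)
  then have "subspace ?U"
    unfolding U subspace_def
    by (simp add: add scale zero dual.subspace_0 dual.subspace_add dual.subspace_scale)
  moreover have "bij_betw ?f ?U (traces scale S)"
    unfolding bij_betw_def
  proof (intro conjI)
    show "inj_on ?f ?U"
    proof (rule inj_onI)
      fix x y assume "?f x = ?f y"
      then have "x * \<G> = y * \<G>"
        by (intro lam_eqI_left) (simp add: dual_mult_def fun_eq_iff)
      then show "x = y"
        by (metis mult.assoc mult.right_neutral special_S(2))
    qed
    show "?f ` ?U = traces scale S"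
    proof
      show "traces scale S \<subseteq> ?f ` ?U"
      proof
        fix t assume t: "t \<in> traces scale S"
        then obtain z where "?f z = t"
          using dual_mult_surj[of t] by (auto simp: traces_def)
        with t show "t \<in> ?f ` ?U"
          unfolding U by blast
      qed
    qed (auto simp: U)
  qed
  ultimately show ?thesis
    unfolding linear_iso_betw_def special_def[symmetric] using traces by (simp add: add scale)
qed

end

theorem propositionA1:
  fixes scale :: "'k::field \<Rightarrow> 'h::ring_1 \<Rightarrow> 'h"
    and \<Delta> :: "'h \<Rightarrow> ('h \<times> 'h) list"
    and \<epsilon> :: "'h \<Rightarrow> 'k"
    and S :: "'h \<Rightarrow> 'h"
    and R :: "('h \<times> 'h) list"
    and \<theta> :: 'h
    and lam :: "'h \<Rightarrow> 'k"
  assumes "ribbon_hopf_algebra scale \<Delta> \<epsilon> S R \<theta>"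
    and "\<exists>B. finite_dimensional_vector_space scale B"
    and "right_integral_dual scale \<Delta> lam"
    and "lam \<noteq> 0"
  shows "linear_iso_betw scale (\<lambda>r f x. r * f x)
    (\<lambda>z. dual_mult lam (z * special_grouplike S R \<theta>))
    {z \<in> L_space scale \<Delta> \<epsilon>. T_map scale \<Delta> \<epsilon> S R z = z}
    (traces scale S)"
proof -
  interpret ribbon_hopf_algebra scale \<Delta> \<epsilon> S R \<theta> by fact
  obtain B where "finite_dimensional_vector_space scale B"
    using assms(2) by blast
  then interpret finite_dimensional_vector_space scale B .
  interpret ribbon_integral scale \<Delta> \<epsilon> S R \<theta> B lam
    by unfold_locales (fact assms)+
  show ?thesis
    by (rule traces_iso)
qed

end
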